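(* Let $\rho\ge 0$ be a fixed integer. Let $\xi_0,\xi_1,\xi_2,\dots$ be independent (not necessarily identically distributed) real-valued random variables with mean $0$, variance $1$ and bounded $(2+\varepsilon_0)$-moments for some $\varepsilon_0>0$, i.e. $\sup_i \mathbf{E}|\xi_i|^{2+\varepsilon_0}<\infty$. Let $f_{\rho,n}(z)=\sum_{i=0}^n a_{i,\rho,n}\xi_i z^i$ with real deterministic coefficients $a_{i,\rho,n}=(1+o_n(1))\,i(i-1)\cdots(i-\rho+1)$, where the $o_n(1)$ term tends to $0$ as $n\to\infty$ uniformly in $0\le i\le n$. Then for every $\varepsilon>0$ there exist positive constants $c_\rho$ and $C_\rho$ such that for every $\zeta\in\mathbb{C}$ with $|\zeta|=1$, both $$\mathbf{P}\big(N_{f_{\rho,n}}(B(\zeta,C_\rho/n))>0\big)\ge 1-\varepsilon$$ and $$\mathbf{P}\big(N_{f_{\rho,n}}(B(\zeta,c_\rho/n))=0\big)\ge 1-\varepsilon$$ hold for all sufficiently large $n$.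
   Context: For a function $f$ and a set $S\subset\mathbb{C}$, $N_f(S)$ denotes the number of roots of $f$ in $S$. $B(\zeta,r)=\{z\in\mathbb{C}:|z-\zeta|<r\}$. For $\rho=0$ the empty product $i(i-1)\cdots(i-\rho+1)$ equals $1$ (Kac polynomial); the $\rho$-th derivative of the Kac polynomial corresponds to $z^{-\rho}f_{\rho,n}(z)$. *)

theory Defs
  imports "HOL-Probability.Probability"
begin

text \<open>
  The count takes values in \<^typ>\<open>enat\<close> because a random polynomial may vanish identically with
  positive probability; it then has infinitely many roots in any ball, whereas \<^const>\<open>card\<close>
  would return 0. Roots are counted without multiplicity.
\<close>

definition num_roots :: "(complex \<Rightarrow> complex) \<Rightarrow> complex set \<Rightarrow> enat" where
  "num_roots f S =
     (if finite {z \<in> S. f z = 0} then enat (card {z \<in> S. f z = 0}) else \<infinity>)"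

definition falling_prod :: "nat \<Rightarrow> nat \<Rightarrow> real" where
  "falling_prod \<rho> i = (\<Prod>k<\<rho>. real i - real k)"

definition random_poly ::
  "(nat \<Rightarrow> nat \<Rightarrow> real) \<Rightarrow> (nat \<Rightarrow> 'a \<Rightarrow> real) \<Rightarrow> nat \<Rightarrow> 'a \<Rightarrow> complex \<Rightarrow> complex" where
  "random_poly a \<xi> n \<omega> z = (\<Sum>i\<le>n. of_real (a n i * \<xi> i \<omega>) * z ^ i)"

end

theory Submission
  imports Defs "HOL-Complex_Analysis.Complex_Analysis" "HOL-Real_Asymp.Real_Asymp"
begin

text \<open>
  Put $g(w) = f(\zeta(1 + w/n)) / n^{\rho + 1/2}$. Its Taylor coefficients satisfy
  $E|c_k| \le 3/k!$, so with high probability $|g| \le e^{(1+\delta)R}$ on the disc of radius $R$,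
  $|g(0)| \le e^{\delta R}$, and $g$ varies by $O(c)$ on the disc of radius $c$.
  A central limit theorem for weighted sums gives a small ball estimate for $g$ at each real point:
  $g(0)$ is rarely small, which excludes roots very close to $\zeta$, and
  $|g(R/8)| \ge e^{(1/8-\delta)R}$ and $|g(-R/8)| \ge e^{-\delta R}$ hold with high probability.
  If $g$ had no zero in the disc of radius $R$, then $\log|g(w)g(-w)|$ would be an even harmonic
  function there, and these bounds would contradict Harnack's inequality.
\<close>

section \<open>Zeros of functions of one-sided exponential growth\<close>

text \<open>Harnack applied to log|g| alone proves nothing: the deficit below the upper bound R is
  about R at 0 and (1 - r)R at rR, which is compatible with the factor (1 - r)/(1 + r) for every r.
  After symmetrization the factor loses only order r^2 while the gain at rR is still of order r, so
  a small r works; in units of 2R the gap is r/2 - 2r^2 to leading order, which r = 1/8 maximizes.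
  The price is a lower bound at -rR. There the standard deviation of g is still at least a power of
  1/R, since indices i \<le> n/R are hardly damped. The slack 1/100 in the exponents absorbs such
  powers and makes the failure probabilities decay exponentially in R. The variables may be
  discrete, so the small ball bounds come only in the limit of n with R fixed. They have no error
  term and do not involve \<zeta>; hence R can be chosen afterwards, once for the whole
  circle.\<close>

lemma Schwarz_even:
  assumes hol: "f holomorphic_on ball 0 1" and f0: "f 0 = 0"
    and bound: "\<And>z. norm z < 1 \<Longrightarrow> norm (f z) < 1"
    and even: "\<And>z. norm z < 1 \<Longrightarrow> f (- z) = f z"
    and z: "norm z < 1"
  shows "norm (f z) \<le> (norm z)\<^sup>2"
proof -
  obtain h where hol_h: "h holomorphic_on ball 0 1"
    and fh: "\<And>z. norm z < 1 \<Longrightarrow> f z = z * h z" and h0: "deriv f 0 = h 0"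
    by (rule Schwarz3 [OF hol f0]) auto
  \<comment> \<open>Evenness forces the derivative at 0 to vanish. Hence \<open>h\<close> vanishes
    at 0 and the Schwarz lemma applies a second time, to \<open>h\<close>, which produces the
    square.\<close>
  have D: "(f has_field_derivative h 0) (at 0)"
    using holomorphic_derivI [OF hol open_ball, of 0] by (simp add: h0)
  then have "((\<lambda>w. f (- w)) has_field_derivative - h 0) (at 0)"
    using DERIV_chain2 [of f "h 0" uminus 0 "- 1" UNIV] DERIV_minus [OF DERIV_ident, of 0 UNIV] by simp
  then have "(f has_field_derivative - h 0) (at 0)"
    by (rule has_field_derivative_transform_within_open [of _ _ _ "ball 0 1"]) (auto simp: even)
  with D have "h 0 = - h 0" by (rule DERIV_unique)
  then have h00: "h 0 = 0" by simp
  have "norm (h w) < 1" if w: "norm w < 1" for w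
  proof (cases "w = 0")
    case False
    \<comment> \<open>Equality in the Schwarz lemma would make \<open>f\<close> a nonzero linear
      map, which is odd. The strict inequality is what lets \<open>h\<close> enter the Schwarz
      lemma.\<close>
    have "norm (f w) \<noteq> norm w"
    proof
      assume "norm (f w) = norm w"
      then obtain \<alpha> where lin: "\<forall>z. norm z < 1 \<longrightarrow> f z = \<alpha> * z" and "norm \<alpha> = 1"
        using Schwarz_Lemma(3) [OF hol f0 bound w] w False by blast
      with even [OF w] lin w have "\<alpha> * w = - (\<alpha> * w)" by simp
      with \<open>norm \<alpha> = 1\<close> False show False by auto
    qed
    with Schwarz_Lemma(1) [OF hol f0 bound w] have "norm w * norm (h w) < norm w"
      using fh [OF w] by (simp add: norm_mult)
    with False show ?thesis by simp
  qed (simp add: h00)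
  from Schwarz_Lemma(1) [OF hol_h h00 this z] have "norm (h z) \<le> norm z" .
  then show ?thesis
    using fh [OF z] by (simp add: norm_mult power2_eq_square mult_left_mono)
qed

text \<open>The Cayley transform \<open>f\<close> takes the right half plane to the unit disc and
  \<open>p 0\<close> to 0. It inherits evenness, so its modulus is at most |z|^2 instead of |z|;
  solving for \<open>Re (p z)\<close> gives Harnack with r replaced by r^2.\<close>

lemma Harnack_even:
  assumes hol: "p holomorphic_on ball 0 1"
    and pos: "\<And>z. norm z < 1 \<Longrightarrow> 0 < Re (p z)"
    and even: "\<And>z. norm z < 1 \<Longrightarrow> p (- z) = p z"
    and z: "norm z < 1"
  shows "(1 - (norm z)\<^sup>2) * Re (p 0) \<le> (1 + (norm z)\<^sup>2) * Re (p z)"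
proof -
  let ?q = "(norm z)\<^sup>2"
  define f where "f w = (p w - p 0) / (p w + cnj (p 0))" for w
  have p0: "0 < Re (p 0)" by (simp add: pos)
  have nz: "p w + cnj (p 0) \<noteq> 0" if "norm w < 1" for w
    using pos [OF that] p0 by (auto simp: complex_eq_iff)
  have less: "norm (p w - p 0) < norm (p w + cnj (p 0))" if "norm w < 1" for w
    unfolding cmod_def using mult_pos_pos [OF pos [OF that] p0]
    by (auto simp: power2_eq_square algebra_simps)
  have "norm (f z) \<le> ?q"
  proof (rule Schwarz_even)
    show "f holomorphic_on ball 0 1"
      unfolding f_def by (intro holomorphic_intros hol) (auto simp: nz)
    show "norm (f w) < 1" if "norm w < 1" for w
      using less [OF that] nz [OF that] by (simp add: f_def norm_divide divide_less_eq)
  qed (auto simp: f_def even z)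
  then have "norm (p z - p 0) \<le> ?q * norm (p z + cnj (p 0))"
    using nz [OF z] by (simp add: f_def norm_divide divide_le_eq)
  then have "(norm (p z - p 0))\<^sup>2 \<le> (?q * norm (p z + cnj (p 0)))\<^sup>2"
    by (rule power_mono) simp
  then have *: "(Re (p z) - Re (p 0))\<^sup>2 + (Im (p z) - Im (p 0))\<^sup>2
      \<le> ?q\<^sup>2 * ((Re (p z) + Re (p 0))\<^sup>2 + (Im (p z) - Im (p 0))\<^sup>2)"
    by (simp add: power_mult_distrib cmod_power2)
  have "?q\<^sup>2 * (Im (p z) - Im (p 0))\<^sup>2 \<le> (Im (p z) - Im (p 0))\<^sup>2"
    using z by (intro mult_left_le_one_le) (auto simp: power_le_one)
  \<comment> \<open>The squared difference of imaginary parts has weight 1 on the left and at most 1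
    on the right of *, so it cancels.\<close>
  with * have "(Re (p z) - Re (p 0))\<^sup>2 \<le> (?q * (Re (p z) + Re (p 0)))\<^sup>2"
    unfolding power_mult_distrib [of ?q] distrib_left [of "?q\<^sup>2"] by linarith
  then have "\<bar>Re (p z) - Re (p 0)\<bar> \<le> ?q * (Re (p z) + Re (p 0))"
    by (rule abs_le_square_iff [THEN iffD2, THEN order_trans])
      (use pos [OF z] p0 in \<open>simp add: abs_mult\<close>)
  then show ?thesis by (simp add: algebra_simps abs_le_iff)
qed

text \<open>
  The even harmonic function $\log|g(Rz)g(-Rz)|$ stays below its upper bound $(2 + 1/50)R$ by at
  least $2R$ at $0$, but by at most $(15/8 + 1/25)R$ at $1/8$. Evenness improves the Harnack factor
  $(1-r)/(1+r)$ to $(1-r^2)/(1+r^2)$, which rules this out.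
\<close>
lemma exponential_growth_imp_zero:
  fixes g :: "complex \<Rightarrow> complex"
  assumes hol: "g holomorphic_on ball 0 R" and "R > 0"
    and upper: "\<And>z. norm z < R \<Longrightarrow> norm (g z) < exp ((1 + 1/100) * R)"
    and center: "norm (g 0) \<le> exp (R / 100)"
    and right: "norm (g (of_real (R / 8))) \<ge> exp ((1/8 - 1/100) * R)"
    and left: "norm (g (of_real (- (R / 8)))) \<ge> exp (- (R / 100))"
  shows "\<exists>z\<in>ball 0 R. g z = 0"
proof (rule ccontr)
  assume "\<not> ?thesis"
  then obtain l where l: "l holomorphic_on ball 0 R" and exp_l: "\<And>z. z \<in> ball 0 R \<Longrightarrow> exp (l z) = g z"
    using holomorphic_logarithm_exists [of "ball 0 R" g 0] hol \<open>R > 0\<close> by auto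
  have norm_g: "norm (g z) = exp (Re (l z))" if "norm z < R" for z
    using exp_l [of z] that by (simp add: norm_exp_eq_Re [symmetric])
  have scale: "norm (complex_of_real R * z) < R" if "norm z < 1" for z
    using that \<open>R > 0\<close> by (simp add: norm_mult)
  define p where "p z = of_real (2 * (1 + 1/100) * R) - (l (of_real R * z) + l (- (of_real R * z)))" for z
  have "(1 - (norm z)\<^sup>2) * Re (p 0) \<le> (1 + (norm z)\<^sup>2) * Re (p z)" if "norm z < 1" for z
  proof (rule Harnack_even [OF _ _ _ that])
    have "(\<lambda>z. l (of_real R * z)) holomorphic_on ball 0 1"
      "(\<lambda>z. l (- (of_real R * z))) holomorphic_on ball 0 1"
      by (rule holomorphic_on_compose_gen [OF _ l, unfolded o_def];
          auto intro!: holomorphic_intros scale)+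
    then show "p holomorphic_on ball 0 1"
      unfolding p_def by (intro holomorphic_intros)
  next
    fix w :: complex assume w: "norm w < 1"
    have "Re (l (of_real R * w)) < (1 + 1/100) * R" "Re (l (- (of_real R * w))) < (1 + 1/100) * R"
      using upper [OF scale [OF w]] upper [of "- (of_real R * w)"] scale [OF w]
      by (simp_all add: norm_g)
    then show "0 < Re (p w)" by (simp add: p_def)
  qed (simp add: p_def)
  from this [of "1/8"] have *: "63 * Re (p 0) \<le> 65 * Re (p (1/8))"
    by (simp add: power2_eq_square field_simps)
  have "Re (l 0) \<le> R / 100"
    using center \<open>R > 0\<close> by (simp add: norm_g)
  moreover have "(1/8 - 1/100) * R \<le> Re (l (of_real R / 8))" "- (R / 100) \<le> Re (l (- (of_real R / 8)))"
    using right left \<open>R > 0\<close> norm_g [of "of_real R / 8"] norm_g [of "- (of_real R / 8)"]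
    by (simp_all add: norm_divide)
  \<comment> \<open>In units of R: \<open>Re (p 0)\<close> is at least 2 and
    \<open>Re (p (1/8))\<close> at most 1.915, but 63 * 2 = 126 exceeds 65 * 1.915 =
    124.475.\<close>
  ultimately show False
    using * \<open>R > 0\<close> by (simp add: p_def)
qed

section \<open>Small ball probabilities of weighted sums\<close>

text \<open>Interpolates between the quadratic and the cubic Taylor remainder of a characteristic
  function, so that a moment of order 2 + e suffices where a third moment need not exist.\<close>

lemma min_square_cube_le:
  fixes s x e :: real
  assumes "0 < e" "e \<le> 1"
  shows "min (6 * x\<^sup>2) (\<bar>s\<bar> * \<bar>x\<bar> ^ 3) \<le> 6 * \<bar>s\<bar> powr e * \<bar>x\<bar> powr (2 + e)"
proof -
  let ?y = "\<bar>s\<bar> * \<bar>x\<bar>"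
  have "min 1 ?y \<le> ?y powr e"
  proof (cases "?y \<ge> 1")
    case True
    then show ?thesis using assms by (simp add: ge_one_powr_ge_zero)
  next
    case False
    then have "?y powr 1 \<le> ?y powr e"
      using assms by (intro powr_mono') auto
    then show ?thesis by (simp add: min_def)
  qed
  then have "6 * x\<^sup>2 * min 1 ?y \<le> 6 * x\<^sup>2 * ?y powr e"
    by (intro mult_left_mono) auto
  moreover have "min (6 * x\<^sup>2) (\<bar>s\<bar> * \<bar>x\<bar> ^ 3) \<le> 6 * x\<^sup>2 * min 1 ?y"
  proof -
    have "\<bar>s\<bar> * \<bar>x\<bar> ^ 3 = x\<^sup>2 * ?y" by (simp add: power2_eq_square power3_eq_cube)
    moreover have "x\<^sup>2 * ?y \<le> 6 * x\<^sup>2 * ?y" by (simp add: mult_right_mono)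
    ultimately show ?thesis
      by (cases "?y \<le> 1") (auto simp only: min_absorb1 min_absorb2 min.cobounded1 mult_1_right
          min_le_iff_disj intro: min.coboundedI2)
  qed
  moreover have "x\<^sup>2 * ?y powr e = \<bar>s\<bar> powr e * \<bar>x\<bar> powr (2 + e)"
    by (cases "x = 0") (simp_all add: powr_mult powr_add)
  ultimately show ?thesis by simp
qed

lemma abs_exp_minus_linear_le:
  fixes x :: real
  assumes "0 \<le> x"
  shows "\<bar>exp (- x) - (1 - x)\<bar> \<le> x\<^sup>2"
proof -
  have "1 - x \<le> exp (- x)" using exp_ge_add_one_self [of "- x"] by simp
  moreover have "exp (- x) \<le> 1 / (1 + x)"
    using exp_ge_add_one_self [of x] assms by (simp add: exp_minus inverse_eq_divide frac_le)
  moreover have "1 / (1 + x) \<le> 1 - x + x\<^sup>2"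
  proof -
    have "1 \<le> (1 - x + x\<^sup>2) * (1 + x)"
      using assms by (simp add: algebra_simps power2_eq_square)
    then show ?thesis using assms by (simp add: divide_le_eq)
  qed
  ultimately show ?thesis by linarith
qed

lemma prob_std_normal_Ioc_le:
  assumes "a \<le> b"
  shows "measure std_normal_distribution {a<..b} \<le> b - a"
proof -
  have "emeasure std_normal_distribution {a<..b}
      = (\<integral>\<^sup>+x. ennreal (std_normal_density x) * indicator {a<..b} x \<partial>lborel)"
    by (simp add: emeasure_density)
  also have "\<dots> \<le> (\<integral>\<^sup>+x. indicator {a<..b} x \<partial>lborel)"
  proof (rule nn_integral_mono)
    fix x :: real
    have "1 \<le> sqrt (2 * pi)" using pi_gt3 by (intro real_le_rsqrt) simp
    then have "std_normal_density x \<le> 1"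
      unfolding std_normal_density_def by (intro mult_le_one) auto
    then show "ennreal (std_normal_density x) * indicator {a<..b} x \<le> indicator {a<..b} x"
      by (simp add: indicator_def)
  qed
  also have "\<dots> = ennreal (b - a)" using assms by simp
  finally show ?thesis
    using assms by (simp add: measure_def enn2real_leI)
qed

text \<open>The uniform bound \<open>K\<close> replaces identical distribution. The cap
  \<open>e \<le> 1\<close> reflects that the remainder interpolates only between second and third
  powers; a larger exponent can be lowered to 1.\<close>

locale standardized_noise = prob_space M for M :: "'a measure" +
  fixes \<xi> :: "nat \<Rightarrow> 'a \<Rightarrow> real" and e K :: real
  assumes indep: "indep_vars (\<lambda>_. borel) \<xi> UNIV"
    and mean: "expectation (\<xi> i) = 0"
    and var: "variance (\<xi> i) = 1"
    and e: "0 < e" "e \<le> 1"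
    and integrable_moment: "integrable M (\<lambda>\<omega>. \<bar>\<xi> i \<omega>\<bar> powr (2 + e))"
    and moment_le: "expectation (\<lambda>\<omega>. \<bar>\<xi> i \<omega>\<bar> powr (2 + e)) \<le> K"
begin

lemma noise_measurable [measurable]: "random_variable borel (\<xi> i)"
  using indep unfolding indep_vars_def2 by simp

lemma expectation_square: "expectation (\<lambda>\<omega>. (\<xi> i \<omega>)\<^sup>2) = 1"
  using var [of i] by (simp add: mean)

lemma integrable_square: "integrable M (\<lambda>\<omega>. (\<xi> i \<omega>)\<^sup>2)"
  \<comment> \<open>The integral of a non-integrable function is 0 by convention, so the value 1
    forces integrability.\<close>
  using expectation_square [of i] not_integrable_integral_eq by fastforce

lemma integrable_noise: "integrable M (\<xi> i)"
  by (rule square_integrable_imp_integrable [OF _ integrable_square]) simp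

lemma K_nonneg: "0 \<le> K"
  using moment_le [of 0] by (rule order_trans [rotated]) simp

text \<open>The comparison is with a Gaussian factor rather than with its quadratic expansion
  because Gaussian factors multiply exactly. The error is o(s^2) uniformly in
  \<open>i\<close>.\<close>

lemma char_noise_approx:
  "norm (char (distr M borel (\<xi> i)) s - exp (- s\<^sup>2 / 2)) \<le> K * s\<^sup>2 * \<bar>s\<bar> powr e + s ^ 4"
proof -
  have "norm (char (distr M borel (\<xi> i)) s - (1 - s\<^sup>2 * 1 / 2))
      \<le> (s\<^sup>2 / 6) * expectation (\<lambda>\<omega>. min (6 * (\<xi> i \<omega>)\<^sup>2) (\<bar>s\<bar> * \<bar>\<xi> i \<omega>\<bar> ^ 3))"
    by (rule char_approx3' [OF noise_measurable integrable_noise integrable_square mean var refl])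
  also have "\<dots> \<le> (s\<^sup>2 / 6) * expectation (\<lambda>\<omega>. 6 * \<bar>s\<bar> powr e * \<bar>\<xi> i \<omega>\<bar> powr (2 + e))"
  proof (intro mult_left_mono integral_mono)
    show "integrable M (\<lambda>\<omega>. min (6 * (\<xi> i \<omega>)\<^sup>2) (\<bar>s\<bar> * \<bar>\<xi> i \<omega>\<bar> ^ 3))"
      by (rule Bochner_Integration.integrable_bound [OF integrable_mult_right [OF integrable_square, of 6 i]]) auto
  qed (auto intro!: integrable_mult_right integrable_moment min_square_cube_le e)
  also have "\<dots> \<le> K * s\<^sup>2 * \<bar>s\<bar> powr e"
    using mult_left_mono [OF moment_le [of i], of "s\<^sup>2 * \<bar>s\<bar> powr e"] by (simp add: mult_ac)
  finally have 1: "norm (char (distr M borel (\<xi> i)) s - of_real (1 - s\<^sup>2 / 2)) \<le> K * s\<^sup>2 * \<bar>s\<bar> powr e"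
    by simp
  have "norm (complex_of_real (1 - s\<^sup>2 / 2) - of_real (exp (- s\<^sup>2 / 2))) = \<bar>exp (- (s\<^sup>2 / 2)) - (1 - s\<^sup>2 / 2)\<bar>"
    by (metis abs_minus_commute minus_divide_left norm_of_real of_real_diff)
  also have "\<dots> \<le> (s\<^sup>2 / 2)\<^sup>2"
    by (rule abs_exp_minus_linear_le) simp
  also have "\<dots> \<le> s ^ 4" by (simp add: power_divide)
  finally show ?thesis
    using norm_triangle_mono [OF 1] by (smt (verit) diff_add_cancel add_diff_eq)
qed

text \<open>Two products of numbers in the unit disc differ by at most the sum of the differences of
  their factors. Each factor errs by at most its squared weight times \<open>?B \<eta>\<close> when
  all weights are at most \<open>\<eta>\<close>, and the squared weights sum to 1, so the total
  error is \<open>?B \<eta>\<close>.\<close>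

lemma weak_conv_weighted_sum:
  fixes b :: "nat \<Rightarrow> nat \<Rightarrow> real"
  assumes normalized: "\<forall>\<^sub>F n in sequentially. (\<Sum>i\<le>n. (b n i)\<^sup>2) = 1"
    and small: "\<And>\<eta>. \<eta> > 0 \<Longrightarrow> \<forall>\<^sub>F n in sequentially. \<forall>i\<le>n. \<bar>b n i\<bar> \<le> \<eta>"
  shows "weak_conv_m (\<lambda>n. distr M borel (\<lambda>\<omega>. \<Sum>i\<le>n. b n i * \<xi> i \<omega>)) std_normal_distribution"
proof (rule levy_continuity)
  fix t :: real
  let ?\<mu> = "\<lambda>n. distr M borel (\<lambda>\<omega>. \<Sum>i\<le>n. b n i * \<xi> i \<omega>)"
  let ?B = "\<lambda>\<eta>. K * t\<^sup>2 * (\<bar>t\<bar> * \<eta>) powr e + t ^ 4 * \<eta>\<^sup>2"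
  have bound: "norm (char (?\<mu> n) t - exp (- t\<^sup>2 / 2)) \<le> ?B \<eta>"
    if sum1: "(\<Sum>i\<le>n. (b n i)\<^sup>2) = 1" and le: "\<forall>i\<le>n. \<bar>b n i\<bar> \<le> \<eta>" and "\<eta> > 0" for n \<eta>
  proof -
    let ?\<phi> = "\<lambda>i. char (distr M borel (\<xi> i)) (t * b n i)"
    have "char (?\<mu> n) t = (\<Prod>i\<le>n. char (distr M borel (\<lambda>\<omega>. b n i * \<xi> i \<omega>)) t)"
      by (rule char_distr_sum) (rule indep_vars_compose2 [OF indep_vars_subset [OF indep]], auto)
    also have "\<dots> = (\<Prod>i\<le>n. ?\<phi> i)"
      by (intro prod.cong refl) (simp add: char_def integral_distr mult_ac)
    finally have char: "char (?\<mu> n) t = (\<Prod>i\<le>n. ?\<phi> i)" .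
    have "exp (- t\<^sup>2 / 2) = exp (\<Sum>i\<le>n. - (t * b n i)\<^sup>2 / 2)"
      by (simp add: power_mult_distrib sum_divide_distrib [symmetric] sum_negf sum_distrib_left [symmetric] sum1)
    also have "\<dots> = (\<Prod>i\<le>n. exp (- (t * b n i)\<^sup>2 / 2))"
      by (simp add: exp_sum)
    finally have gauss: "exp (- t\<^sup>2 / 2) = (\<Prod>i\<le>n. exp (- (t * b n i)\<^sup>2 / 2))" .
    have "norm (char (?\<mu> n) t - exp (- t\<^sup>2 / 2)) \<le> (\<Sum>i\<le>n. norm (?\<phi> i - of_real (exp (- (t * b n i)\<^sup>2 / 2))))"
      unfolding char gauss of_real_prod
      by (rule norm_prod_diff)
        (auto intro!: real_distribution.cmod_char_le_1 real_distribution_distr)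
    also have "\<dots> \<le> (\<Sum>i\<le>n. (b n i)\<^sup>2 * ?B \<eta>)"
    proof (rule sum_mono)
      fix i assume "i \<in> {..n}"
      with le have b: "\<bar>b n i\<bar> \<le> \<eta>" by simp
      then have "\<bar>t * b n i\<bar> powr e \<le> (\<bar>t\<bar> * \<eta>) powr e"
        using e by (intro powr_mono2) (auto simp: abs_mult mult_left_mono)
      then have 1: "K * (t * b n i)\<^sup>2 * \<bar>t * b n i\<bar> powr e \<le> K * (t * b n i)\<^sup>2 * (\<bar>t\<bar> * \<eta>) powr e"
        using K_nonneg by (intro mult_left_mono) auto
      have "(b n i)\<^sup>2 \<le> \<eta>\<^sup>2" using b by (metis abs_ge_zero power2_abs power_mono)
      then have "(t ^ 4 * (b n i)\<^sup>2) * (b n i)\<^sup>2 \<le> (t ^ 4 * (b n i)\<^sup>2) * \<eta>\<^sup>2"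
        by (intro mult_left_mono) auto
      then have 2: "(t * b n i) ^ 4 \<le> (b n i)\<^sup>2 * (t ^ 4 * \<eta>\<^sup>2)"
        by (simp add: power_mult_distrib power2_eq_square power4_eq_xxxx mult_ac)
      show "norm (?\<phi> i - of_real (exp (- (t * b n i)\<^sup>2 / 2))) \<le> (b n i)\<^sup>2 * ?B \<eta>"
        using char_noise_approx [of i "t * b n i"] 1 2 by (simp add: algebra_simps power_mult_distrib)
    qed
    also have "\<dots> = ?B \<eta>"
      by (simp only: sum_distrib_right [symmetric] sum1 mult_1_left)
    finally show ?thesis .
  qed
  \<comment> \<open>\<open>\<eta>\<close> is sent to 0 from the right, which keeps the base of
    \<open>powr\<close> nonnegative.\<close>
  have B_lim: "(?B \<longlongrightarrow> K * t\<^sup>2 * (\<bar>t\<bar> * 0) powr e + t ^ 4 * 0\<^sup>2) (at_right 0)"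
    using e by (intro tendsto_intros tendsto_powr') (auto simp: eventually_at_right_less eventually_at_filter)
  have "(\<lambda>n. char (?\<mu> n) t) \<longlonglongrightarrow> of_real (exp (- t\<^sup>2 / 2))"
  proof (rule tendstoI)
    fix r :: real assume "r > 0"
    have "\<forall>\<^sub>F \<eta> in at_right 0. ?B \<eta> < r"
      using order_tendstoD(2) [OF B_lim, of r] \<open>r > 0\<close> by simp
    then have "\<forall>\<^sub>F \<eta> in at_right 0. ?B \<eta> < r \<and> \<eta> > 0"
      by (intro eventually_conj eventually_at_right_less)
    then obtain \<eta> where \<eta>: "?B \<eta> < r" "\<eta> > 0"
      using eventually_happens [of _ "at_right (0::real)"] by force
    from small [OF \<eta>(2)] normalized
    show "\<forall>\<^sub>F n in sequentially. dist (char (?\<mu> n) t) (of_real (exp (- t\<^sup>2 / 2))) < r"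
      by eventually_elim (use bound [OF _ _ \<eta>(2)] \<eta>(1) in \<open>auto simp: dist_norm intro: le_less_trans\<close>)
  qed
  then show "(\<lambda>n. char (?\<mu> n) t) \<longlonglongrightarrow> char std_normal_distribution t"
    by (simp add: char_std_normal_distribution)
qed (auto intro!: real_dist_normal_dist real_distribution_distr)

text \<open>The Gaussian mass of the interval is at most 2t and its endpoints are null. The constant
  3 leaves room for the error of the weak convergence, so the bound holds eventually with no error
  term.\<close>

lemma small_ball_real:
  fixes b :: "nat \<Rightarrow> nat \<Rightarrow> real"
  assumes "\<forall>\<^sub>F n in sequentially. (\<Sum>i\<le>n. (b n i)\<^sup>2) = 1"
    and "\<And>\<eta>. \<eta> > 0 \<Longrightarrow> \<forall>\<^sub>F n in sequentially. \<forall>i\<le>n. \<bar>b n i\<bar> \<le> \<eta>"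
    and "t > 0"
  shows "\<forall>\<^sub>F n in sequentially. prob {\<omega> \<in> space M. \<bar>\<Sum>i\<le>n. b n i * \<xi> i \<omega>\<bar> < t} \<le> 3 * t"
proof -
  let ?\<mu> = "\<lambda>n. distr M borel (\<lambda>\<omega>. \<Sum>i\<le>n. b n i * \<xi> i \<omega>)"
  have null: "emeasure lborel {- t, t} = 0"
    by (rule emeasure_lborel_countable) simp
  have "emeasure std_normal_distribution {- t, t} = 0"
    by (simp add: emeasure_density nn_integral_0_iff_AE)
      (intro AE_I [of _ _ "{- t, t}"], auto simp: indicator_def null)
  then have "emeasure std_normal_distribution (frontier {- t<..t}) = 0"
    using \<open>t > 0\<close> by (simp add: frontier_def)
  then have "(\<lambda>n. measure (?\<mu> n) {- t<..t}) \<longlonglongrightarrow> measure std_normal_distribution {- t<..t}"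
    by (intro weak_conv_imp_continuity_set_conv weak_conv_weighted_sum assms)
      (auto intro!: real_dist_normal_dist real_distribution_distr)
  moreover have "measure std_normal_distribution {- t<..t} < 3 * t"
    using prob_std_normal_Ioc_le [of "- t" t] \<open>t > 0\<close> by simp
  ultimately have "\<forall>\<^sub>F n in sequentially. measure (?\<mu> n) {- t<..t} < 3 * t"
    by (rule order_tendstoD)
  then show ?thesis
  proof eventually_elim
    case (elim n)
    have "prob {\<omega> \<in> space M. \<bar>\<Sum>i\<le>n. b n i * \<xi> i \<omega>\<bar> < t} \<le> measure (?\<mu> n) {- t<..t}"
      by (subst measure_distr) (auto intro!: finite_measure_mono)
    with elim show ?case by simp
  qed
qed

text \<open>A one-dimensional limit theorem suffices, because a small modulus makes both the real
  and the imaginary part small. Which part is used may change with \<open>n\<close>: the limit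
  theorem is for triangular arrays, so no convergence of covariance matrices is required.\<close>

lemma small_ball_complex:
  fixes v :: "nat \<Rightarrow> nat \<Rightarrow> complex"
  assumes large: "\<forall>\<^sub>F n in sequentially. s\<^sup>2 \<le> (\<Sum>i\<le>n. (norm (v n i))\<^sup>2)" and "s > 0"
    and small: "\<And>\<eta>. \<eta> > 0 \<Longrightarrow> \<forall>\<^sub>F n in sequentially. \<forall>i\<le>n. norm (v n i) \<le> \<eta>"
    and "t > 0"
  shows "\<forall>\<^sub>F n in sequentially.
    prob {\<omega> \<in> space M. norm (\<Sum>i\<le>n. v n i * of_real (\<xi> i \<omega>)) < t * s} \<le> 6 * t"
proof -
  \<comment> \<open>the part, real or imaginary, that carries at least half of the variance\<close>
  define part where "part n = (if (\<Sum>i\<le>n. (Im (v n i))\<^sup>2) \<le> (\<Sum>i\<le>n. (Re (v n i))\<^sup>2) then Re else Im)" for n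
  define S where "S n = sqrt (\<Sum>i\<le>n. (part n (v n i))\<^sup>2)" for n
  have part_le: "\<bar>part n z\<bar> \<le> norm z" for n z
    by (simp add: part_def abs_Re_le_cmod abs_Im_le_cmod)
  have part_sum: "part n (\<Sum>i\<le>n. v n i * of_real (\<xi> i \<omega>)) = (\<Sum>i\<le>n. part n (v n i) * \<xi> i \<omega>)" for n \<omega>
    by (simp add: part_def)
  \<comment> \<open>The natural bound is s / sqrt 2; \<open>s / 2\<close> avoids the root and turns
    the radius \<open>t\<close> into \<open>2 * t\<close> after normalization.\<close>
  have S_ge: "\<forall>\<^sub>F n in sequentially. s / 2 \<le> S n"
    using large
  proof eventually_elim
    case (elim n)
    have "(\<Sum>i\<le>n. (norm (v n i))\<^sup>2) = (\<Sum>i\<le>n. (Re (v n i))\<^sup>2) + (\<Sum>i\<le>n. (Im (v n i))\<^sup>2)"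
      by (simp add: cmod_power2 sum.distrib)
    with elim have "s\<^sup>2 \<le> 2 * (\<Sum>i\<le>n. (part n (v n i))\<^sup>2)"
      by (simp add: part_def)
    then have "(s / 2)\<^sup>2 \<le> (\<Sum>i\<le>n. (part n (v n i))\<^sup>2)"
      by (simp add: power_divide) (smt (verit) zero_le_power2)
    then show ?case unfolding S_def by (rule real_le_rsqrt)
  qed
  let ?b = "\<lambda>n i. part n (v n i) / S n"
  have "\<forall>\<^sub>F n in sequentially. prob {\<omega> \<in> space M. \<bar>\<Sum>i\<le>n. ?b n i * \<xi> i \<omega>\<bar> < 2 * t} \<le> 3 * (2 * t)"
  proof (rule small_ball_real)
    show "\<forall>\<^sub>F n in sequentially. (\<Sum>i\<le>n. (?b n i)\<^sup>2) = 1"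
      using S_ge
    proof eventually_elim
      case (elim n)
      have "(\<Sum>i\<le>n. (?b n i)\<^sup>2) = (\<Sum>i\<le>n. (part n (v n i))\<^sup>2) / (S n)\<^sup>2"
        by (simp add: power_divide sum_divide_distrib)
      also have "(\<Sum>i\<le>n. (part n (v n i))\<^sup>2) = (S n)\<^sup>2" by (simp add: S_def sum_nonneg)
      finally show ?case
        using elim \<open>s > 0\<close> by simp
    qed
  next
    fix \<eta> :: real assume "\<eta> > 0"
    with \<open>s > 0\<close> have "\<forall>\<^sub>F n in sequentially. \<forall>i\<le>n. norm (v n i) \<le> \<eta> * (s / 2)"
      by (intro small) simp
    with S_ge show "\<forall>\<^sub>F n in sequentially. \<forall>i\<le>n. \<bar>?b n i\<bar> \<le> \<eta>"
    proof eventually_elim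
      case (elim n)
      have "\<eta> * (s / 2) \<le> \<eta> * S n" using elim \<open>\<eta> > 0\<close> by (intro mult_left_mono) auto
      then show ?case
        using elim \<open>s > 0\<close> part_le [of n] by (auto simp: abs_divide divide_le_eq) (smt (verit))+
    qed
  qed (use \<open>t > 0\<close> in auto)
  with S_ge show ?thesis
  proof eventually_elim
    case (elim n)
    have "\<bar>\<Sum>i\<le>n. ?b n i * \<xi> i \<omega>\<bar> < 2 * t"
      if "norm (\<Sum>i\<le>n. v n i * of_real (\<xi> i \<omega>)) < t * s" for \<omega>
    proof -
      have "\<bar>\<Sum>i\<le>n. ?b n i * \<xi> i \<omega>\<bar> = \<bar>part n (\<Sum>i\<le>n. v n i * of_real (\<xi> i \<omega>))\<bar> / S n"
        using elim(1) \<open>s > 0\<close> by (simp add: part_sum flip: sum_divide_distrib)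
      also have "\<dots> \<le> norm (\<Sum>i\<le>n. v n i * of_real (\<xi> i \<omega>)) / (s / 2)"
        using elim(1) \<open>s > 0\<close> part_le by (intro frac_le) auto
      also have "\<dots> < 2 * t" using that \<open>s > 0\<close> by (simp add: field_simps)
      finally show ?thesis .
    qed
    then have "prob {\<omega> \<in> space M. norm (\<Sum>i\<le>n. v n i * of_real (\<xi> i \<omega>)) < t * s}
        \<le> prob {\<omega> \<in> space M. \<bar>\<Sum>i\<le>n. ?b n i * \<xi> i \<omega>\<bar> < 2 * t}"
      by (intro finite_measure_mono) auto
    with elim show ?case by simp
  qed
qed

end

section \<open>The polynomial on the scale $1/n$\<close>

text \<open>On a compact ball a zero exists iff |f| gets arbitrarily small on a countable dense
  subset, which is a countable condition. The open ball is a countable union of closed ones.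
  Measurability is required by the final passage to complements.\<close>

lemma (in prob_space) sets_zero_in_ball:
  fixes f :: "'a \<Rightarrow> complex \<Rightarrow> complex"
  assumes [measurable]: "\<And>z. (\<lambda>\<omega>. f \<omega> z) \<in> borel_measurable M"
    and cont: "\<And>\<omega>. continuous_on UNIV (f \<omega>)"
  shows "{\<omega> \<in> space M. \<exists>z\<in>ball c r. f \<omega> z = 0} \<in> events"
proof -
  have cball: "{\<omega> \<in> space M. \<exists>z\<in>cball c s. f \<omega> z = 0} \<in> events" for s
  proof -
    obtain D where D: "countable D" "D \<subseteq> cball c s" "cball c s \<subseteq> closure D"
      by (rule separable)
    have "(\<exists>z\<in>cball c s. f \<omega> z = 0) \<longleftrightarrow> (\<forall>m. \<exists>q\<in>D. norm (f \<omega> q) < inverse (real (Suc m)))" for \<omega>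
    proof
      assume "\<exists>z\<in>cball c s. f \<omega> z = 0"
      then obtain z where z: "z \<in> closure D" "f \<omega> z = 0" using D by auto
      have "f \<omega> z \<in> closure (f \<omega> ` D)"
        using image_closure_subset [of D "f \<omega>" "closure (f \<omega> ` D)"] z cont
        by (metis closed_closure closure_subset continuous_on_subset image_subset_iff subset_UNIV)
      then show "\<forall>m. \<exists>q\<in>D. norm (f \<omega> q) < inverse (real (Suc m))"
        using z(2) by (auto simp: closure_approachable)
    next
      assume *: "\<forall>m. \<exists>q\<in>D. norm (f \<omega> q) < inverse (real (Suc m))"
      \<comment> \<open>The radius may be negative. The test over the then empty \<open>D\<close>
        fails, so passing it already shows that the ball is nonempty.\<close>
      then have "cball c s \<noteq> {}" using D by auto
      moreover have "continuous_on (cball c s) (\<lambda>z. norm (f \<omega> z))"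
        by (intro continuous_on_norm continuous_on_subset [OF cont]) simp
      ultimately obtain z where z: "z \<in> cball c s" "\<forall>y\<in>cball c s. norm (f \<omega> z) \<le> norm (f \<omega> y)"
        using continuous_attains_inf [OF compact_cball] by meson
      have "norm (f \<omega> z) < inverse (real (Suc m))" for m
        using * z(2) D(2) by (meson le_less_trans subsetD)
      then have "norm (f \<omega> z) = 0"
        using reals_Archimedean [of "norm (f \<omega> z)"] by (metis less_asym norm_ge_zero order_le_less)
      then show "\<exists>z\<in>cball c s. f \<omega> z = 0" using z(1) by auto
    qed
    then show ?thesis using D(1) by simp
  qed
  have "(\<exists>z\<in>ball c r. f \<omega> z = 0) \<longleftrightarrow> (\<exists>k. \<exists>z\<in>cball c (r - inverse (real (Suc k))). f \<omega> z = 0)" for \<omega>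
  proof
    assume "\<exists>z\<in>ball c r. f \<omega> z = 0"
    then obtain z where z: "dist c z < r" "f \<omega> z = 0" by auto
    then obtain k where "inverse (real (Suc k)) < r - dist c z"
      using reals_Archimedean [of "r - dist c z"] by auto
    with z show "\<exists>k. \<exists>z\<in>cball c (r - inverse (real (Suc k))). f \<omega> z = 0"
      by (intro exI [of _ k] bexI [of _ z]) auto
  next
    assume "\<exists>k. \<exists>z\<in>cball c (r - inverse (real (Suc k))). f \<omega> z = 0"
    then obtain k z where z: "dist c z \<le> r - inverse (real (Suc k))" "f \<omega> z = 0" by auto
    have "dist c z < r" by (rule le_less_trans [OF z(1)]) simp
    with z show "\<exists>z\<in>ball c r. f \<omega> z = 0" by auto
  qed
  then have "{\<omega> \<in> space M. \<exists>z\<in>ball c r. f \<omega> z = 0}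
      = (\<Union>k. {\<omega> \<in> space M. \<exists>z\<in>cball c (r - inverse (real (Suc k))). f \<omega> z = 0})"
    by auto
  then show ?thesis using cball by auto
qed

lemma (in prob_space) expectation_le_sqrt_second_moment:
  fixes X :: "'a \<Rightarrow> real"
  assumes [measurable]: "random_variable borel X" and "integrable M (\<lambda>\<omega>. (X \<omega>)\<^sup>2)"
  shows "expectation X \<le> sqrt (expectation (\<lambda>\<omega>. (X \<omega>)\<^sup>2))"
proof -
  have "integrable M X" by (rule square_integrable_imp_integrable [OF assms])
  then have "(expectation X)\<^sup>2 \<le> expectation (\<lambda>\<omega>. (X \<omega>)\<^sup>2)"
    using variance_eq [of X] variance_positive [of X] assms by simp
  then show ?thesis by (rule real_le_rsqrt)
qed

text \<open>The coefficients are a plain real sequence, so that everything deterministic can be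
  proved outcome by outcome; the normalization and the noise are put into \<open>x\<close>
  later.\<close>

definition local_poly :: "(nat \<Rightarrow> real) \<Rightarrow> complex \<Rightarrow> nat \<Rightarrow> complex \<Rightarrow> complex" where
  "local_poly x \<zeta> n w = (\<Sum>i\<le>n. of_real (x i) * (\<zeta> * (1 + w / of_nat n)) ^ i)"

definition taylor_coeff :: "(nat \<Rightarrow> real) \<Rightarrow> complex \<Rightarrow> nat \<Rightarrow> nat \<Rightarrow> complex" where
  "taylor_coeff x \<zeta> n k = (\<Sum>i\<le>n. of_real (x i * real (i choose k) / real n ^ k) * \<zeta> ^ i)"

lemma local_poly_eq_taylor: "local_poly x \<zeta> n w = (\<Sum>k\<le>n. taylor_coeff x \<zeta> n k * w ^ k)"
proof -
  have "(1 + w / of_nat n) ^ i = (\<Sum>k\<le>n. of_nat (i choose k) * (w / of_nat n) ^ k)" if "i \<le> n" for i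
  proof -
    have "(1 + w / of_nat n) ^ i = (\<Sum>k\<le>i. of_nat (i choose k) * (w / of_nat n) ^ k)"
      using binomial_ring [of "w / of_nat n" 1 i] by (simp add: add.commute)
    also have "\<dots> = (\<Sum>k\<le>n. of_nat (i choose k) * (w / of_nat n) ^ k)"
      using that by (intro sum.mono_neutral_left) (auto simp: binomial_eq_0)
    finally show ?thesis .
  qed
  then have "local_poly x \<zeta> n w
      = (\<Sum>i\<le>n. \<Sum>k\<le>n. of_real (x i) * \<zeta> ^ i * (of_nat (i choose k) * (w / of_nat n) ^ k))"
    by (simp add: local_poly_def power_mult_distrib sum_distrib_left mult.assoc)
  also have "\<dots> = (\<Sum>k\<le>n. \<Sum>i\<le>n. of_real (x i) * \<zeta> ^ i * (of_nat (i choose k) * (w / of_nat n) ^ k))"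
    by (rule sum.swap)
  also have "\<dots> = (\<Sum>k\<le>n. taylor_coeff x \<zeta> n k * w ^ k)"
    by (simp add: taylor_coeff_def sum_distrib_left power_divide mult_ac)
  finally show ?thesis .
qed

lemma holomorphic_on_local_poly: "local_poly x \<zeta> n holomorphic_on S"
  unfolding local_poly_eq_taylor [abs_def] by (intro holomorphic_intros)

text \<open>One random variable that dominates |g| on a whole disc. Its expectation is a finite sum
  of first moments, so no supremum over uncountably many points has to be estimated.\<close>

definition taylor_majorant :: "(nat \<Rightarrow> real) \<Rightarrow> complex \<Rightarrow> nat \<Rightarrow> real \<Rightarrow> real" where
  "taylor_majorant x \<zeta> n r = (\<Sum>k\<le>n. norm (taylor_coeff x \<zeta> n k) * r ^ k)"

lemma norm_local_poly_le: "norm w \<le> r \<Longrightarrow> norm (local_poly x \<zeta> n w) \<le> taylor_majorant x \<zeta> n r"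
  unfolding local_poly_eq_taylor taylor_majorant_def
  by (rule sum_norm_le) (simp add: norm_mult norm_power mult_left_mono power_mono)

text \<open>The constant term cancels (\<open>0 ^ 0\<close> is 1), and every other power of
  \<open>w\<close> is at most \<open>c\<close> in modulus because \<open>c \<le> 1\<close>.\<close>

lemma norm_local_poly_diff_le:
  assumes "norm w \<le> c" "c \<le> 1"
  shows "norm (local_poly x \<zeta> n w - local_poly x \<zeta> n 0) \<le> c * taylor_majorant x \<zeta> n 1"
proof -
  have "norm (taylor_coeff x \<zeta> n k * w ^ k - taylor_coeff x \<zeta> n k * 0 ^ k)
      \<le> c * norm (taylor_coeff x \<zeta> n k)" for k
  proof (cases k)
    case 0
    have "0 \<le> c" using assms(1) norm_ge_zero [of w] by linarith
    with 0 show ?thesis by simp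
  next
    case (Suc j)
    have "norm w ^ Suc j \<le> c * 1"
      using assms norm_ge_zero [of w] unfolding power_Suc
      by (intro mult_mono power_le_one) (auto simp del: norm_ge_zero)
    then show ?thesis
      using Suc by (simp add: norm_mult norm_power mult_left_mono mult.commute [of c])
  qed
  then show ?thesis
    unfolding local_poly_eq_taylor taylor_majorant_def sum_subtractf [symmetric] sum_distrib_left
    by (intro sum_norm_le) simp
qed

section \<open>Moments of the Taylor coefficients\<close>

context standardized_noise
begin

lemma expectation_mult:
  "integrable M (\<lambda>\<omega>. \<xi> i \<omega> * \<xi> j \<omega>)"
  "expectation (\<lambda>\<omega>. \<xi> i \<omega> * \<xi> j \<omega>) = (if i = j then 1 else 0)"
proof -
  have "integrable M (\<lambda>\<omega>. \<xi> i \<omega> * \<xi> j \<omega>) \<and> expectation (\<lambda>\<omega>. \<xi> i \<omega> * \<xi> j \<omega>) = (if i = j then 1 else 0)"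
  proof (cases "i = j")
    case True
    then show ?thesis
      using integrable_square [of i] expectation_square [of i] by (simp add: power2_eq_square)
  next
    case False
    have ind: "indep_vars (\<lambda>_. borel) \<xi> {i, j}"
      by (rule indep_vars_subset [OF indep]) simp
    show ?thesis
      using indep_vars_integrable [OF _ ind] indep_vars_lebesgue_integral [OF _ ind] False
      by (simp add: integrable_noise mean)
  qed
  then show "integrable M (\<lambda>\<omega>. \<xi> i \<omega> * \<xi> j \<omega>)"
    "expectation (\<lambda>\<omega>. \<xi> i \<omega> * \<xi> j \<omega>) = (if i = j then 1 else 0)" by auto
qed

lemma second_moment_real:
  fixes b :: "nat \<Rightarrow> real"
  shows "integrable M (\<lambda>\<omega>. (\<Sum>i\<le>n. b i * \<xi> i \<omega>)\<^sup>2)"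
    and "expectation (\<lambda>\<omega>. (\<Sum>i\<le>n. b i * \<xi> i \<omega>)\<^sup>2) = (\<Sum>i\<le>n. (b i)\<^sup>2)"
proof -
  have eq: "(\<Sum>i\<le>n. b i * \<xi> i \<omega>)\<^sup>2 = (\<Sum>i\<le>n. \<Sum>j\<le>n. b i * b j * (\<xi> i \<omega> * \<xi> j \<omega>))" for \<omega>
    by (simp add: power2_eq_square sum_product mult_ac)
  show "integrable M (\<lambda>\<omega>. (\<Sum>i\<le>n. b i * \<xi> i \<omega>)\<^sup>2)"
    unfolding eq by (intro Bochner_Integration.integrable_sum integrable_mult_right expectation_mult)
  have "expectation (\<lambda>\<omega>. (\<Sum>i\<le>n. b i * \<xi> i \<omega>)\<^sup>2)
      = (\<Sum>i\<le>n. \<Sum>j\<le>n. b i * b j * (if i = j then 1 else 0))"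
    unfolding eq by (simp add: expectation_mult)
  also have "\<dots> = (\<Sum>i\<le>n. (b i)\<^sup>2)"
    by (simp add: if_distrib [of "\<lambda>x. _ * x"] sum.delta' power2_eq_square cong: if_cong)
  finally show "expectation (\<lambda>\<omega>. (\<Sum>i\<le>n. b i * \<xi> i \<omega>)\<^sup>2) = (\<Sum>i\<le>n. (b i)\<^sup>2)" .
qed

lemma second_moment:
  fixes v :: "nat \<Rightarrow> complex"
  shows "integrable M (\<lambda>\<omega>. (norm (\<Sum>i\<le>n. v i * of_real (\<xi> i \<omega>)))\<^sup>2)"
    and "expectation (\<lambda>\<omega>. (norm (\<Sum>i\<le>n. v i * of_real (\<xi> i \<omega>)))\<^sup>2) = (\<Sum>i\<le>n. (norm (v i))\<^sup>2)"
proof -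
  have eq: "(norm (\<Sum>i\<le>n. v i * of_real (\<xi> i \<omega>)))\<^sup>2
      = (\<Sum>i\<le>n. Re (v i) * \<xi> i \<omega>)\<^sup>2 + (\<Sum>i\<le>n. Im (v i) * \<xi> i \<omega>)\<^sup>2" for \<omega>
    by (simp add: cmod_power2)
  show "integrable M (\<lambda>\<omega>. (norm (\<Sum>i\<le>n. v i * of_real (\<xi> i \<omega>)))\<^sup>2)"
    unfolding eq by (intro Bochner_Integration.integrable_add second_moment_real)
  show "expectation (\<lambda>\<omega>. (norm (\<Sum>i\<le>n. v i * of_real (\<xi> i \<omega>)))\<^sup>2) = (\<Sum>i\<le>n. (norm (v i))\<^sup>2)"
    unfolding eq by (simp add: second_moment_real cmod_power2 sum.distrib)
qed

text \<open>The ratio of \<open>i choose k\<close> to n^k is at most 1 / k!, so the coefficient is a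
  sum of n + 1 orthogonal terms, each with a weight of at most 2 / (sqrt n * k!). Its second moment
  bounds the first.\<close>

lemma taylor_coeff_first_moment:
  fixes \<alpha> :: "nat \<Rightarrow> real"
  assumes "n > 0" and \<alpha>: "\<And>i. i \<le> n \<Longrightarrow> \<bar>\<alpha> i\<bar> \<le> 2 / sqrt n" and "norm \<zeta> = 1"
  shows "integrable M (\<lambda>\<omega>. norm (taylor_coeff (\<lambda>i. \<alpha> i * \<xi> i \<omega>) \<zeta> n k))"
    and "expectation (\<lambda>\<omega>. norm (taylor_coeff (\<lambda>i. \<alpha> i * \<xi> i \<omega>) \<zeta> n k)) \<le> 3 / fact k"
proof -
  define v where "v i = of_real (\<alpha> i * real (i choose k) / real n ^ k) * \<zeta> ^ i" for i
  have eq: "taylor_coeff (\<lambda>i. \<alpha> i * \<xi> i \<omega>) \<zeta> n k = (\<Sum>i\<le>n. v i * of_real (\<xi> i \<omega>))" for \<omega>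
    by (simp add: taylor_coeff_def v_def mult_ac)
  show int: "integrable M (\<lambda>\<omega>. norm (taylor_coeff (\<lambda>i. \<alpha> i * \<xi> i \<omega>) \<zeta> n k))"
    unfolding eq by (intro integrable_norm Bochner_Integration.integrable_sum integrable_mult_right
      integrable_of_real integrable_noise)
  have v_le: "norm (v i) \<le> 2 / sqrt n / fact k" if "i \<le> n" for i
  proof -
    have "(i choose k) * fact k \<le> i ^ k" by (rule binomial_fact_pow)
    also have "\<dots> \<le> n ^ k" using that by (rule power_mono) simp
    finally have "real (i choose k) * fact k \<le> real n ^ k"
      by (metis of_nat_fact of_nat_le_iff of_nat_mult of_nat_power)
    then have "real (i choose k) / real n ^ k \<le> 1 / fact k"
      using \<open>n > 0\<close> by (simp add: field_simps)
    then have "\<bar>\<alpha> i\<bar> * (real (i choose k) / real n ^ k) \<le> (2 / sqrt n) * (1 / fact k)"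
      by (intro mult_mono \<alpha> that) auto
    then show ?thesis
      using \<open>norm \<zeta> = 1\<close> by (simp add: v_def norm_mult norm_power norm_divide abs_mult)
  qed
  have "(\<Sum>i\<le>n. (norm (v i))\<^sup>2) \<le> (\<Sum>i\<le>n. (2 / sqrt n / fact k)\<^sup>2)"
    by (intro sum_mono power_mono v_le) auto
  also have "\<dots> = (real n + 1) * (4 / n) / (fact k)\<^sup>2"
    by (simp add: power_divide power_mult_distrib algebra_simps)
  \<comment> \<open>4(n + 1)/n is at most 8 for n \<ge> 1; 9 is the next square.\<close>
  also have "\<dots> \<le> 9 / (fact k)\<^sup>2"
    using \<open>n > 0\<close> by (intro divide_right_mono) (auto simp: field_simps)
  finally have "sqrt (\<Sum>i\<le>n. (norm (v i))\<^sup>2) \<le> sqrt ((3 / fact k)\<^sup>2)"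
    by (simp add: power_divide)
  then show "expectation (\<lambda>\<omega>. norm (taylor_coeff (\<lambda>i. \<alpha> i * \<xi> i \<omega>) \<zeta> n k)) \<le> 3 / fact k"
    using expectation_le_sqrt_second_moment [OF _ second_moment(1) [of v n]]
    unfolding eq second_moment by simp
qed

text \<open>The factorial decay yields the exponential series, hence growth rate 1 in
  \<open>r\<close>. Markov's inequality at the rate 1 + 1/100 then fails with exponentially small
  probability.\<close>

lemma taylor_majorant_first_moment:
  fixes \<alpha> :: "nat \<Rightarrow> real"
  assumes "n > 0" "\<And>i. i \<le> n \<Longrightarrow> \<bar>\<alpha> i\<bar> \<le> 2 / sqrt n" "norm \<zeta> = 1" and "r \<ge> 0"
  shows "integrable M (\<lambda>\<omega>. taylor_majorant (\<lambda>i. \<alpha> i * \<xi> i \<omega>) \<zeta> n r)"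
    and "expectation (\<lambda>\<omega>. taylor_majorant (\<lambda>i. \<alpha> i * \<xi> i \<omega>) \<zeta> n r) \<le> 3 * exp r"
proof -
  note T = taylor_coeff_first_moment [OF assms(1-3)]
  show "integrable M (\<lambda>\<omega>. taylor_majorant (\<lambda>i. \<alpha> i * \<xi> i \<omega>) \<zeta> n r)"
    unfolding taylor_majorant_def by (intro Bochner_Integration.integrable_sum integrable_mult_left T)
  have "expectation (\<lambda>\<omega>. taylor_majorant (\<lambda>i. \<alpha> i * \<xi> i \<omega>) \<zeta> n r)
      = (\<Sum>k\<le>n. expectation (\<lambda>\<omega>. norm (taylor_coeff (\<lambda>i. \<alpha> i * \<xi> i \<omega>) \<zeta> n k)) * r ^ k)"
    unfolding taylor_majorant_def by (simp add: T)
  also have "\<dots> \<le> (\<Sum>k\<le>n. 3 / fact k * r ^ k)"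
    using \<open>r \<ge> 0\<close> by (intro sum_mono mult_right_mono T) auto
  also have "\<dots> = 3 * (\<Sum>k\<le>n. inverse (fact k) * r ^ k)"
    by (simp add: sum_distrib_left divide_inverse mult_ac)
  also have "(\<Sum>k\<le>n. inverse (fact k) * r ^ k) \<le> exp r"
    unfolding exp_def using \<open>r \<ge> 0\<close> summable_exp [of r]
    by (auto simp: scaleR_conv_of_real mult_ac divide_inverse intro!: sum_le_suminf)
  finally show "expectation (\<lambda>\<omega>. taylor_majorant (\<lambda>i. \<alpha> i * \<xi> i \<omega>) \<zeta> n r) \<le> 3 * exp r"
    by simp
qed

end

section \<open>Zeros near a point of the unit circle\<close>

lemma abs_falling_prod_le: "\<bar>falling_prod \<rho> i\<bar> \<le> real i ^ \<rho>"
proof (cases "i < \<rho>")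
  \<comment> \<open>Here single factors can exceed \<open>i\<close> in modulus, so the factorwise
    bound breaks down; but the factor with k = i is 0.\<close>
  case True
  then have "falling_prod \<rho> i = 0" unfolding falling_prod_def by (auto intro!: prod_zero)
  then show ?thesis by simp
next
  case False
  have "\<bar>falling_prod \<rho> i\<bar> = (\<Prod>k<\<rho>. \<bar>real i - real k\<bar>)"
    by (simp add: falling_prod_def abs_prod)
  also have "\<dots> \<le> (\<Prod>k<\<rho>. real i)"
    using False by (intro prod_mono) auto
  finally show ?thesis by simp
qed

lemma falling_prod_ge:
  assumes "2 * \<rho> \<le> i"
  shows "(real i / 2) ^ \<rho> \<le> falling_prod \<rho> i"
proof -
  have "(\<Prod>k<\<rho>. real i / 2) \<le> falling_prod \<rho> i"
    unfolding falling_prod_def using assms by (intro prod_mono) auto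
  then show ?thesis by simp
qed

lemma card_nat_between_ge:
  fixes a b :: real
  assumes "0 \<le> a"
  shows "b - a - 1 \<le> card {i::nat. a \<le> i \<and> i \<le> b}"
proof (cases "a \<le> b")
  case True
  have "{nat \<lceil>a\<rceil>..nat \<lfloor>b\<rfloor>} = {i::nat. a \<le> i \<and> i \<le> b}"
    using assms True by (auto simp: nat_le_iff le_nat_iff ceiling_le_iff le_floor_iff)
  then have "card {i::nat. a \<le> i \<and> i \<le> b} = Suc (nat \<lfloor>b\<rfloor>) - nat \<lceil>a\<rceil>"
    by (metis card_atLeastAtMost)
  moreover have "real (nat \<lfloor>b\<rfloor>) > b - 1" "real (nat \<lceil>a\<rceil>) < a + 1"
    using assms True by linarith+
  ultimately show ?thesis by linarith
qed (use of_nat_0_le_iff in \<open>smt (verit)\<close>)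

text \<open>Only two-sided size bounds on the normalized coefficients are kept. The lower one is
  restricted to indices proportional to \<open>n\<close>, because falling products vanish at small
  indices.\<close>

locale scaled_noise = standardized_noise +
  fixes \<alpha> :: "nat \<Rightarrow> nat \<Rightarrow> real" and \<rho> :: nat
  assumes upper: "\<forall>\<^sub>F n in sequentially. \<forall>i\<le>n. \<bar>\<alpha> n i\<bar> \<le> 2 / sqrt n"
    and lower: "\<And>\<gamma>::real. \<gamma> > 0 \<Longrightarrow>
      \<forall>\<^sub>F n in sequentially. \<forall>i\<le>n. \<gamma> * real n \<le> real i \<longrightarrow> (\<gamma> / 2) ^ \<rho> / (2 * sqrt n) \<le> \<bar>\<alpha> n i\<bar>"
begin

abbreviation P :: "complex \<Rightarrow> nat \<Rightarrow> 'a \<Rightarrow> complex \<Rightarrow> complex" where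
  "P \<zeta> n \<omega> \<equiv> local_poly (\<lambda>i. \<alpha> n i * \<xi> i \<omega>) \<zeta> n"

abbreviation majorant :: "complex \<Rightarrow> nat \<Rightarrow> 'a \<Rightarrow> real \<Rightarrow> real" where
  "majorant \<zeta> n \<omega> \<equiv> taylor_majorant (\<lambda>i. \<alpha> n i * \<xi> i \<omega>) \<zeta> n"

lemma P_measurable [measurable]: "(\<lambda>\<omega>. P \<zeta> n \<omega> w) \<in> borel_measurable M"
  unfolding local_poly_def by measurable

lemma majorant_measurable [measurable]: "(\<lambda>\<omega>. majorant \<zeta> n \<omega> r) \<in> borel_measurable M"
  unfolding taylor_majorant_def taylor_coeff_def by measurable

lemma sets_P_zero: "{\<omega> \<in> space M. \<exists>w\<in>ball 0 r. P \<zeta> n \<omega> w = 0} \<in> events"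
  by (intro sets_zero_in_ball P_measurable holomorphic_on_imp_continuous_on holomorphic_on_local_poly)

lemma prob_majorant_ge:
  assumes "norm \<zeta> = 1" "r \<ge> 0" "q > 0"
  shows "\<forall>\<^sub>F n in sequentially. prob {\<omega> \<in> space M. q \<le> majorant \<zeta> n \<omega> r} \<le> 3 * exp r / q"
  using upper eventually_gt_at_top [of 0]
proof eventually_elim
  case (elim n)
  note F = taylor_majorant_first_moment [of n "\<alpha> n" \<zeta> r, OF elim(2) _ assms(1,2)]
  have "prob {\<omega> \<in> space M. q \<le> majorant \<zeta> n \<omega> r} \<le> expectation (\<lambda>\<omega>. majorant \<zeta> n \<omega> r) / q"
    using elim(1) assms
    by (intro integral_Markov_inequality_measure [where A = "space M"] F)
      (auto simp: taylor_majorant_def intro!: sum_nonneg)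
  also have "\<dots> \<le> 3 * exp r / q"
    using elim(1) \<open>q > 0\<close> by (intro divide_right_mono F) auto
  finally show ?case .
qed

text \<open>Only the window from \<gamma>n to \<beta>n is counted. At least (\<beta> - \<gamma>)n/2
  indices lie in it, and each contributes at least the square of m(\<gamma>/2)^\<rho> / (2 sqrt n).
  The window is left free because the dominant indices depend on the sign of
  \<open>u\<close>.\<close>

lemma variance_ge:
  fixes \<zeta> :: complex
  assumes "norm \<zeta> = 1" "0 < \<gamma>" "\<gamma> < \<beta>" "\<beta> \<le> 1" "m \<ge> 0"
    and m: "\<forall>\<^sub>F n in sequentially. \<forall>i. \<gamma> * real n \<le> real i \<longrightarrow> real i \<le> \<beta> * real n \<longrightarrow> m \<le> \<bar>1 + u / real n\<bar> ^ i"
  shows "\<forall>\<^sub>F n in sequentially. (m * (\<gamma> / 2) ^ \<rho> * sqrt ((\<beta> - \<gamma>) / 8))\<^sup>2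
    \<le> (\<Sum>i\<le>n. (norm (of_real (\<alpha> n i) * (\<zeta> * (1 + of_real u / of_nat n)) ^ i))\<^sup>2)"
proof -
  have "\<forall>\<^sub>F n in sequentially. 2 / (\<beta> - \<gamma>) \<le> real n"
    using filterlim_real_sequentially by (auto simp: filterlim_at_top)
  with lower [OF \<open>0 < \<gamma>\<close>] m eventually_gt_at_top [of 0] show ?thesis
  proof eventually_elim
    case (elim n)
    let ?I = "{i::nat. \<gamma> * n \<le> i \<and> i \<le> \<beta> * n}"
    let ?v = "\<lambda>i. of_real (\<alpha> n i) * (\<zeta> * (1 + of_real u / of_nat n)) ^ i"
    let ?x = "((\<gamma> / 2) ^ \<rho> / (2 * sqrt n) * m)\<^sup>2"
    have "\<beta> * n \<le> n" using mult_right_mono [OF \<open>\<beta> \<le> 1\<close>, of "real n"] by simp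
    then have I: "?I \<subseteq> {..n}" by auto
    have norm_v: "norm (?v i) = \<bar>\<alpha> n i\<bar> * \<bar>1 + u / n\<bar> ^ i" for i
    proof -
      have "(1 + of_real u / of_nat n) = complex_of_real (1 + u / n)" by simp
      then show ?thesis
        using \<open>norm \<zeta> = 1\<close> by (metis norm_mult norm_power norm_of_real mult_1)
    qed
    \<comment> \<open>The rounding loss of 1 in the count costs at most half of the window.\<close>
    have "1 \<le> (\<beta> - \<gamma>) * n / 2"
      using elim(4) \<open>\<gamma> < \<beta>\<close> by (simp add: field_simps)
    then have "(\<beta> - \<gamma>) * n / 2 \<le> card ?I"
      using card_nat_between_ge [of "\<gamma> * n" "\<beta> * n"] \<open>0 < \<gamma>\<close> by (simp add: algebra_simps)
    then have "(\<beta> - \<gamma>) * n / 2 * ?x \<le> card ?I * ?x"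
      by (rule mult_right_mono) simp
    also have "\<dots> \<le> (\<Sum>i\<in>?I. (norm (?v i))\<^sup>2)"
    proof -
      have "?x \<le> (norm (?v i))\<^sup>2" if "i \<in> ?I" for i
        unfolding norm_v using that I elim(1,2) assms(2,5) by (intro power_mono mult_mono) auto
      then show ?thesis using sum_bounded_below [of ?I ?x "\<lambda>i. (norm (?v i))\<^sup>2"] by simp
    qed
    also have "\<dots> \<le> (\<Sum>i\<le>n. (norm (?v i))\<^sup>2)"
      using I by (intro sum_mono2) auto
    finally have *: "(\<beta> - \<gamma>) * n / 2 * ?x \<le> (\<Sum>i\<le>n. (norm (?v i))\<^sup>2)" .
    have eq: "(m * G * sqrt ((\<beta> - \<gamma>) / 8))\<^sup>2 = (\<beta> - \<gamma>) * n / 2 * (G / (2 * sqrt n) * m)\<^sup>2" for G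
    proof -
      have "(m * G * sqrt ((\<beta> - \<gamma>) / 8))\<^sup>2 = m\<^sup>2 * G\<^sup>2 * ((\<beta> - \<gamma>) / 8)"
        using \<open>\<gamma> < \<beta>\<close> unfolding power_mult_distrib by simp
      moreover have "(G / (2 * sqrt n) * m)\<^sup>2 = G\<^sup>2 * m\<^sup>2 / (4 * real n)"
        unfolding power_mult_distrib power_divide by simp
      ultimately show ?thesis using elim(3) by simp
    qed
    show ?case unfolding eq by (rule *)
  qed
qed

text \<open>No single summand of \<open>P\<close> at a real point dominates: for i \<le> n the power
  is at most exp |u|, so the weights are O(1 / sqrt n).\<close>

lemma coeff_small:
  fixes \<zeta> :: complex
  assumes "norm \<zeta> = 1" "\<eta> > 0"
  shows "\<forall>\<^sub>F n in sequentially. \<forall>i\<le>n. norm (of_real (\<alpha> n i) * (\<zeta> * (1 + of_real u / of_nat n)) ^ i) \<le> \<eta>"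
proof -
  have "(\<lambda>n. 2 / sqrt (real n) * exp \<bar>u\<bar>) \<longlonglongrightarrow> 0" by real_asymp
  then have "\<forall>\<^sub>F n in sequentially. 2 / sqrt (real n) * exp \<bar>u\<bar> < \<eta>"
    using \<open>\<eta> > 0\<close> by (rule order_tendstoD)
  with upper eventually_gt_at_top [of 0] show ?thesis
  proof eventually_elim
    case (elim n)
    show ?case
    proof (intro allI impI)
      fix i assume "i \<le> n"
      have "norm (1 + of_real u / of_nat n :: complex) \<le> 1 + \<bar>u\<bar> / n"
        by (rule norm_triangle_le) (simp add: norm_divide)
      also have "\<dots> \<le> exp (\<bar>u\<bar> / n)" by (rule exp_ge_add_one_self)
      finally have "norm (1 + of_real u / of_nat n :: complex) ^ i \<le> exp (\<bar>u\<bar> / n) ^ i"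
        by (rule power_mono) simp
      also have "\<dots> \<le> exp (\<bar>u\<bar> / n) ^ n"
        using \<open>i \<le> n\<close> by (intro power_increasing) auto
      also have "\<dots> = exp \<bar>u\<bar>"
        using elim(2) by (simp flip: exp_of_nat_mult)
      finally have "norm (of_real (\<alpha> n i) * (\<zeta> * (1 + of_real u / of_nat n)) ^ i) \<le> 2 / sqrt n * exp \<bar>u\<bar>"
        using elim(1) \<open>i \<le> n\<close> \<open>norm \<zeta> = 1\<close>
        unfolding norm_mult norm_power norm_of_real by (intro mult_mono) auto
      with elim(3) show "norm (of_real (\<alpha> n i) * (\<zeta> * (1 + of_real u / of_nat n)) ^ i) \<le> \<eta>" by simp
    qed
  qed
qed

lemma small_ball_P:
  assumes "norm \<zeta> = 1" "0 < \<gamma>" "\<gamma> < \<beta>" "\<beta> \<le> 1" "m > 0"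
    and "\<forall>\<^sub>F n in sequentially. \<forall>i. \<gamma> * real n \<le> real i \<longrightarrow> real i \<le> \<beta> * real n \<longrightarrow> m \<le> \<bar>1 + u / real n\<bar> ^ i"
    and "q > 0"
  shows "\<forall>\<^sub>F n in sequentially. prob {\<omega> \<in> space M. norm (P \<zeta> n \<omega> (of_real u)) < q}
    \<le> 6 * (q / (m * (\<gamma> / 2) ^ \<rho> * sqrt ((\<beta> - \<gamma>) / 8)))"
proof -
  define s where "s = m * (\<gamma> / 2) ^ \<rho> * sqrt ((\<beta> - \<gamma>) / 8)"
  let ?v = "\<lambda>n i. of_real (\<alpha> n i) * (\<zeta> * (1 + of_real u / of_nat n)) ^ i"
  have s: "s > 0" using assms by (simp add: s_def)
  have "P \<zeta> n \<omega> (of_real u) = (\<Sum>i\<le>n. ?v n i * of_real (\<xi> i \<omega>))" for n \<omega>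
    by (simp add: local_poly_def mult_ac)
  moreover have "\<forall>\<^sub>F n in sequentially.
      prob {\<omega> \<in> space M. norm (\<Sum>i\<le>n. ?v n i * of_real (\<xi> i \<omega>)) < q / s * s} \<le> 6 * (q / s)"
  proof (rule small_ball_complex)
    show "\<forall>\<^sub>F n in sequentially. s\<^sup>2 \<le> (\<Sum>i\<le>n. (norm (?v n i))\<^sup>2)"
      unfolding s_def using assms by (intro variance_ge) auto
  qed (use assms s coeff_small in auto)
  ultimately show ?thesis using s by (simp add: s_def [symmetric])
qed

lemma prob_zero_near_le:
  assumes "\<epsilon> > 0"
  shows "\<exists>c>0. \<forall>\<zeta>. norm \<zeta> = 1 \<longrightarrow>
    (\<forall>\<^sub>F n in sequentially. prob {\<omega> \<in> space M. \<exists>w\<in>ball 0 c. P \<zeta> n \<omega> w = 0} \<le> \<epsilon>)"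
proof -
  \<comment> \<open>The window is [1/2, 1] and m = 1, since the base is 1 at u = 0. The choice of
    \<open>q\<close> makes the small ball bound \<epsilon>/2, and \<open>c\<close> then makes the
    Markov bound at most \<epsilon>/2; the cap at 1 is for the estimate of the variation.\<close>
  let ?s = "1 * ((1/2) / 2) ^ \<rho> * sqrt ((1 - 1/2) / 8) :: real"
  define q where "q = \<epsilon> / 12 * ?s"
  define c where "c = min 1 (q * \<epsilon> / (6 * exp 1))"
  have "?s > 0" by simp
  then have "q > 0" unfolding q_def using assms by (intro mult_pos_pos) auto
  then have "c > 0" "c \<le> 1" using assms by (auto simp: c_def)
  have "\<forall>\<^sub>F n in sequentially. prob {\<omega> \<in> space M. \<exists>w\<in>ball 0 c. P \<zeta> n \<omega> w = 0} \<le> \<epsilon>"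
    if "norm \<zeta> = 1" for \<zeta>
  proof -
    have "\<forall>\<^sub>F n in sequentially. prob {\<omega> \<in> space M. norm (P \<zeta> n \<omega> (of_real 0)) < q} \<le> 6 * (q / ?s)"
      using that \<open>q > 0\<close> by (intro small_ball_P) auto
    moreover have "\<forall>\<^sub>F n in sequentially. prob {\<omega> \<in> space M. q / c \<le> majorant \<zeta> n \<omega> 1} \<le> 3 * exp 1 / (q / c)"
      using that \<open>q > 0\<close> \<open>c > 0\<close> by (intro prob_majorant_ge) auto
    ultimately show ?thesis
    proof eventually_elim
      case (elim n)
      let ?A = "{\<omega> \<in> space M. norm (P \<zeta> n \<omega> (of_real 0)) < q}"
      let ?B = "{\<omega> \<in> space M. q / c \<le> majorant \<zeta> n \<omega> 1}"
      have "{\<omega> \<in> space M. \<exists>w\<in>ball 0 c. P \<zeta> n \<omega> w = 0} \<subseteq> ?A \<union> ?B"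
      proof safe
        fix \<omega> w assume \<omega>: "\<omega> \<in> space M" "w \<in> ball 0 c" "P \<zeta> n \<omega> w = 0"
          and ge: "\<not> q / c \<le> majorant \<zeta> n \<omega> 1"
        have "norm (P \<zeta> n \<omega> 0) \<le> c * majorant \<zeta> n \<omega> 1"
          using norm_local_poly_diff_le [of w c "\<lambda>i. \<alpha> n i * \<xi> i \<omega>" \<zeta> n] \<omega> \<open>c \<le> 1\<close> by simp
        also have "\<dots> < q" using ge \<open>c > 0\<close> by (simp add: field_simps)
        finally show "norm (P \<zeta> n \<omega> (of_real 0)) < q" by simp
      qed
      then have "prob {\<omega> \<in> space M. \<exists>w\<in>ball 0 c. P \<zeta> n \<omega> w = 0} \<le> prob (?A \<union> ?B)"
        by (intro finite_measure_mono) auto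
      also have "\<dots> \<le> prob ?A + prob ?B"
        by (intro measure_Un_le) auto
      also have "\<dots> \<le> \<epsilon> / 2 + \<epsilon> / 2"
      proof (rule add_mono)
        show "prob ?A \<le> \<epsilon> / 2" using elim(1) \<open>?s > 0\<close> by (simp add: q_def)
        have "c \<le> q * \<epsilon> / (6 * exp 1)" by (simp add: c_def)
        then have "3 * exp 1 / (q / c) \<le> \<epsilon> / 2" using \<open>q > 0\<close> by (simp add: field_simps)
        with elim(2) show "prob ?B \<le> \<epsilon> / 2" by simp
      qed
      finally show ?case by simp
    qed
  qed
  with \<open>c > 0\<close> show ?thesis by blast
qed

text \<open>The four summands bound the probabilities that one of the four size conditions of
  \<open>exponential_growth_imp_zero\<close> fails: two by Markov's inequality, two by small ball
  estimates.\<close>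

lemma prob_no_zero_le:
  assumes "R \<ge> 1" "norm \<zeta> = 1"
  shows "\<forall>\<^sub>F n in sequentially. prob {\<omega> \<in> space M. \<not> (\<exists>w\<in>ball 0 R. P \<zeta> n \<omega> w = 0)}
    \<le> 3 * exp R / exp ((1 + 1/100) * R) + 3 * exp 0 / exp (R / 100)
      + 6 * (exp ((1/8 - 1/100) * R) / ((exp (R / 8) / 2) powr (24/25) * ((24/25) / 2) ^ \<rho> * sqrt ((1 - 24/25) / 8)))
      + 6 * (exp (- (R / 100)) / (7/8 * ((1 / (2 * R)) / 2) ^ \<rho> * sqrt ((1 / R - 1 / (2 * R)) / 8)))"
proof -
  have "\<forall>\<^sub>F n in sequentially. prob {\<omega> \<in> space M. exp ((1 + 1/100) * R) \<le> majorant \<zeta> n \<omega> R}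
      \<le> 3 * exp R / exp ((1 + 1/100) * R)"
    using assms by (intro prob_majorant_ge) auto
  \<comment> \<open>At radius 0 the majorant is the modulus of the constant term, so Markov also
    controls the value at the centre.\<close>
  moreover have "\<forall>\<^sub>F n in sequentially. prob {\<omega> \<in> space M. exp (R / 100) \<le> majorant \<zeta> n \<omega> 0}
      \<le> 3 * exp 0 / exp (R / 100)"
    using assms by (intro prob_majorant_ge) auto
  \<comment> \<open>On the window [24/25, 1] the power is about exp(3R/25) = exp(0.12 R), which
    still beats the threshold exp(0.115 R). Halving exp(R/8) makes its limit formula usable for
    finite \<open>n\<close> and costs only a constant.\<close>
  moreover have "\<forall>\<^sub>F n in sequentially.
      prob {\<omega> \<in> space M. norm (P \<zeta> n \<omega> (of_real (R / 8))) < exp ((1/8 - 1/100) * R)}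
      \<le> 6 * (exp ((1/8 - 1/100) * R) / ((exp (R / 8) / 2) powr (24/25) * ((24/25) / 2) ^ \<rho> * sqrt ((1 - 24/25) / 8)))"
  proof (rule small_ball_P)
    have "(\<lambda>n. (1 + (R / 8) / real n) ^ n) \<longlonglongrightarrow> exp (R / 8)"
      by (rule tendsto_exp_limit_sequentially)
    then have "\<forall>\<^sub>F n in sequentially. exp (R / 8) / 2 < (1 + (R / 8) / real n) ^ n"
      by (rule order_tendstoD) simp
    then show "\<forall>\<^sub>F n in sequentially. \<forall>i. 24/25 * real n \<le> real i \<longrightarrow> real i \<le> 1 * real n \<longrightarrow>
        (exp (R / 8) / 2) powr (24/25) \<le> \<bar>1 + R / 8 / real n\<bar> ^ i"
    proof eventually_elim
      case (elim n)
      show ?case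
      proof (intro allI impI)
        fix i assume i: "24/25 * real n \<le> real i"
        let ?b = "1 + R / 8 / real n"
        have b: "1 \<le> ?b" using \<open>R \<ge> 1\<close> by simp
        have "(exp (R / 8) / 2) powr (24/25) \<le> (?b ^ n) powr (24/25)"
          using elim by (intro powr_mono2) auto
        also have "\<dots> = ?b powr (24/25 * real n)"
          using b by (simp add: powr_powr mult.commute flip: powr_realpow)
        also have "\<dots> \<le> ?b powr real i"
          using b i by (intro powr_mono) auto
        also have "\<dots> = \<bar>?b\<bar> ^ i"
          using b by (simp add: powr_realpow)
        finally show "(exp (R / 8) / 2) powr (24/25) \<le> \<bar>?b\<bar> ^ i" .
      qed
    qed
  qed (use assms in auto)
  \<comment> \<open>For i \<le> n/R, Bernoulli's inequality keeps the power above 1 - 1/8. The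
    window is of relative length 1/(2R), so the bound loses only a power of R, which exp(-R/100)
    outweighs.\<close>
  moreover have "\<forall>\<^sub>F n in sequentially.
      prob {\<omega> \<in> space M. norm (P \<zeta> n \<omega> (of_real (- (R / 8)))) < exp (- (R / 100))}
      \<le> 6 * (exp (- (R / 100)) / (7/8 * ((1 / (2 * R)) / 2) ^ \<rho> * sqrt ((1 / R - 1 / (2 * R)) / 8)))"
  proof (rule small_ball_P)
    have "\<forall>\<^sub>F n in sequentially. R \<le> real n"
      using filterlim_real_sequentially by (auto simp: filterlim_at_top)
    then show "\<forall>\<^sub>F n in sequentially. \<forall>i. 1 / (2 * R) * real n \<le> real i \<longrightarrow> real i \<le> 1 / R * real n \<longrightarrow>
        7/8 \<le> \<bar>1 + - (R / 8) / real n\<bar> ^ i"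
    proof eventually_elim
      case (elim n)
      show ?case
      proof (intro allI impI)
        fix i assume i: "real i \<le> 1 / R * real n"
        have n: "0 < real n" using elim \<open>R \<ge> 1\<close> by linarith
        have x: "- (R / 8) / real n \<ge> - 1" using elim n by (simp add: field_simps)
        have "7/8 \<le> 1 + real i * (- (R / 8) / real n)"
          using i n \<open>R \<ge> 1\<close> by (simp add: field_simps)
        also have "\<dots> \<le> (1 + - (R / 8) / real n) ^ i"
          using x by (rule Bernoulli_inequality)
        also have "\<dots> = \<bar>1 + - (R / 8) / real n\<bar> ^ i" using x by simp
        finally show "7/8 \<le> \<bar>1 + - (R / 8) / real n\<bar> ^ i" .
      qed
    qed
  qed (use assms in \<open>auto simp: field_simps\<close>)
  ultimately show ?thesis
  proof eventually_elim
    case (elim n)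
    let ?A = "{\<omega> \<in> space M. exp ((1 + 1/100) * R) \<le> majorant \<zeta> n \<omega> R}"
    let ?B = "{\<omega> \<in> space M. exp (R / 100) \<le> majorant \<zeta> n \<omega> 0}"
    let ?C = "{\<omega> \<in> space M. norm (P \<zeta> n \<omega> (of_real (R / 8))) < exp ((1/8 - 1/100) * R)}"
    let ?D = "{\<omega> \<in> space M. norm (P \<zeta> n \<omega> (of_real (- (R / 8)))) < exp (- (R / 100))}"
    have "{\<omega> \<in> space M. \<not> (\<exists>w\<in>ball 0 R. P \<zeta> n \<omega> w = 0)} \<subseteq> ?A \<union> ?B \<union> ?C \<union> ?D"
    proof (rule subsetI, rule ccontr)
      fix \<omega> assume \<omega>: "\<omega> \<in> {\<omega> \<in> space M. \<not> (\<exists>w\<in>ball 0 R. P \<zeta> n \<omega> w = 0)}"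
        and not: "\<omega> \<notin> ?A \<union> ?B \<union> ?C \<union> ?D"
      have "\<exists>w\<in>ball 0 R. P \<zeta> n \<omega> w = 0"
      proof (rule exponential_growth_imp_zero)
        show "norm (P \<zeta> n \<omega> w) < exp ((1 + 1/100) * R)" if "norm w < R" for w
          using norm_local_poly_le [of w R "\<lambda>i. \<alpha> n i * \<xi> i \<omega>" \<zeta> n] that not \<omega> by auto
        show "norm (P \<zeta> n \<omega> 0) \<le> exp (R / 100)"
          using norm_local_poly_le [of 0 0 "\<lambda>i. \<alpha> n i * \<xi> i \<omega>" \<zeta> n] not \<omega> by auto
      qed (use not \<omega> assms in \<open>auto simp: holomorphic_on_local_poly\<close>)
      with \<omega> show False by simp
    qed
    then have "prob {\<omega> \<in> space M. \<not> (\<exists>w\<in>ball 0 R. P \<zeta> n \<omega> w = 0)} \<le> prob (?A \<union> ?B \<union> ?C \<union> ?D)"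
      by (intro finite_measure_mono) auto
    also have "\<dots> \<le> prob (?A \<union> ?B \<union> ?C) + prob ?D"
      by (intro measure_Un_le) auto
    also have "prob (?A \<union> ?B \<union> ?C) \<le> prob (?A \<union> ?B) + prob ?C"
      by (intro measure_Un_le) auto
    also have "prob (?A \<union> ?B) \<le> prob ?A + prob ?B"
      by (intro measure_Un_le) auto
    finally show ?case using elim by linarith
  qed
qed

text \<open>The four summands decay like exp(-R/100), exp(-R/100), exp(-R/200) and R^(\<rho> + 1/2)
  exp(-R/100). None involves \<zeta>, so one \<open>R\<close> serves the whole circle.\<close>

lemma prob_no_zero_near_le:
  assumes "\<epsilon> > 0"
  shows "\<exists>R>0. \<forall>\<zeta>. norm \<zeta> = 1 \<longrightarrow>
    (\<forall>\<^sub>F n in sequentially. prob {\<omega> \<in> space M. \<not> (\<exists>w\<in>ball 0 R. P \<zeta> n \<omega> w = 0)} \<le> \<epsilon>)"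
proof -
  let ?b = "\<lambda>R::real. 3 * exp R / exp ((1 + 1/100) * R) + 3 * exp 0 / exp (R / 100)
      + 6 * (exp ((1/8 - 1/100) * R) / ((exp (R / 8) / 2) powr (24/25) * ((24/25) / 2) ^ \<rho> * sqrt ((1 - 24/25) / 8)))
      + 6 * (exp (- (R / 100)) / (7/8 * ((1 / (2 * R)) / 2) ^ \<rho> * sqrt ((1 / R - 1 / (2 * R)) / 8)))"
  have "(?b \<longlongrightarrow> 0) at_top" by real_asymp
  then have "\<forall>\<^sub>F R in at_top. ?b R < \<epsilon>"
    using assms by (rule order_tendstoD)
  then obtain R where R: "?b R < \<epsilon>" "R \<ge> 1"
    using eventually_happens [OF eventually_conj [OF _ eventually_ge_at_top [of 1]]] by force
  have "\<forall>\<^sub>F n in sequentially. prob {\<omega> \<in> space M. \<not> (\<exists>w\<in>ball 0 R. P \<zeta> n \<omega> w = 0)} \<le> \<epsilon>"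
    if "norm \<zeta> = 1" for \<zeta>
    using prob_no_zero_le [OF R(2) that] by eventually_elim (use R(1) in linarith)
  with R(2) show ?thesis by (intro exI [of _ R]) auto
qed

end

section \<open>From the given polynomial to the rescaled one\<close>

lemma normalized_coefficients:
  fixes a \<delta> :: "nat \<Rightarrow> nat \<Rightarrow> real"
  assumes a: "\<And>n i. i \<le> n \<Longrightarrow> a n i = (1 + \<delta> n i) * falling_prod \<rho> i"
    and \<delta>: "\<And>\<eta>. \<eta> > 0 \<Longrightarrow> \<forall>\<^sub>F n in sequentially. \<forall>i\<le>n. \<bar>\<delta> n i\<bar> < \<eta>"
  shows "\<forall>\<^sub>F n in sequentially. \<forall>i\<le>n. \<bar>a n i / (real n ^ \<rho> * sqrt n)\<bar> \<le> 2 / sqrt n" (is ?upper)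
    and "\<gamma> > 0 \<Longrightarrow> \<forall>\<^sub>F n in sequentially. \<forall>i\<le>n. \<gamma> * real n \<le> real i \<longrightarrow>
      (\<gamma> / 2) ^ \<rho> / (2 * sqrt n) \<le> \<bar>a n i / (real n ^ \<rho> * sqrt n)\<bar>" (is "_ \<Longrightarrow> ?lower")
proof -
  have \<delta>_half: "\<forall>\<^sub>F n in sequentially. \<forall>i\<le>n. \<bar>\<delta> n i\<bar> < 1/2" by (intro \<delta>) simp
  with eventually_gt_at_top [of 0] show ?upper
  proof eventually_elim
    case (elim n)
    show ?case
    proof (intro allI impI)
      fix i assume "i \<le> n"
      with elim(2) have "\<bar>1 + \<delta> n i\<bar> \<le> 2" by (smt (verit) field_sum_of_halves)
      moreover have "\<bar>falling_prod \<rho> i\<bar> \<le> real n ^ \<rho>"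
        using abs_falling_prod_le [of \<rho> i] power_mono [of "real i" "real n" \<rho>] \<open>i \<le> n\<close> by simp
      ultimately have "\<bar>a n i\<bar> \<le> 2 * real n ^ \<rho>"
        using \<open>i \<le> n\<close> by (simp add: a abs_mult mult_mono)
      then show "\<bar>a n i / (real n ^ \<rho> * sqrt n)\<bar> \<le> 2 / sqrt n"
        using elim(1) by (simp add: abs_mult divide_simps)
    qed
  qed
  show ?lower if "\<gamma> > 0"
  proof -
    have "\<forall>\<^sub>F n in sequentially. 2 * \<rho> / \<gamma> \<le> real n"
      using filterlim_real_sequentially by (auto simp: filterlim_at_top)
    with \<delta>_half eventually_gt_at_top [of 0] show ?thesis
    proof eventually_elim
      case (elim n)
      show ?case
      proof (intro allI impI)
        fix i assume i: "i \<le> n" "\<gamma> * real n \<le> real i"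
        \<comment> \<open>This puts every index of the window beyond 2\<rho>, where each factor i -
          k of the falling product is at least i/2.\<close>
        have "2 * \<rho> \<le> \<gamma> * real n" using elim(3) that by (simp add: field_simps)
        with i have "2 * \<rho> \<le> i" by linarith
        have "(\<gamma> / 2) ^ \<rho> * real n ^ \<rho> = (\<gamma> * real n / 2) ^ \<rho>"
          by (simp flip: power_mult_distrib)
        also have "\<dots> \<le> (real i / 2) ^ \<rho>"
          using i that by (intro power_mono) auto
        also have "\<dots> \<le> \<bar>falling_prod \<rho> i\<bar>"
          using falling_prod_ge [OF \<open>2 * \<rho> \<le> i\<close>] by simp
        finally have "1/2 * ((\<gamma> / 2) ^ \<rho> * real n ^ \<rho>) \<le> \<bar>1 + \<delta> n i\<bar> * \<bar>falling_prod \<rho> i\<bar>"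
          using elim(1) i that by (intro mult_mono) (smt (verit) field_sum_of_halves, auto)
        then have "(\<gamma> / 2) ^ \<rho> * real n ^ \<rho> \<le> 2 * \<bar>a n i\<bar>"
          using i by (simp add: a abs_mult)
        then have "(\<gamma> / 2) ^ \<rho> \<le> 2 * \<bar>a n i\<bar> / real n ^ \<rho>"
          using elim(2) by (simp add: pos_le_divide_eq)
        then have "(\<gamma> / 2) ^ \<rho> / (2 * sqrt n) \<le> 2 * \<bar>a n i\<bar> / real n ^ \<rho> / (2 * sqrt n)"
          by (rule divide_right_mono) simp
        then show "(\<gamma> / 2) ^ \<rho> / (2 * sqrt n) \<le> \<bar>a n i / (real n ^ \<rho> * sqrt n)\<bar>"
          by (simp add: abs_mult)
      qed
    qed
  qed
qed

text \<open>Lowering the exponent is paid for by adding 1: |x|^p is at most 1 where |x| \<le> 1, and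
  at most the higher power elsewhere. A finite supremum of nonnegative integrals yields both
  integrability and the uniform bound.\<close>

lemma standardized_noiseI:
  fixes \<xi> :: "nat \<Rightarrow> 'a \<Rightarrow> real"
  assumes "prob_space M" and indep: "prob_space.indep_vars M (\<lambda>_. borel) \<xi> UNIV"
    and "\<And>i. prob_space.expectation M (\<xi> i) = 0" "\<And>i. prob_space.variance M (\<xi> i) = 1"
    and "\<epsilon> > 0"
    and sup: "(SUP i. \<integral>\<^sup>+\<omega>. ennreal (\<bar>\<xi> i \<omega>\<bar> powr (2 + \<epsilon>)) \<partial>M) < \<infinity>"
  shows "\<exists>K. standardized_noise M \<xi> (min 1 \<epsilon>) K"
proof -
  interpret prob_space M by fact
  have [measurable]: "random_variable borel (\<xi> i)" for i
    using indep unfolding indep_vars_def2 by simp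
  obtain B where B: "B \<ge> 0" "(SUP i. \<integral>\<^sup>+\<omega>. ennreal (\<bar>\<xi> i \<omega>\<bar> powr (2 + \<epsilon>)) \<partial>M) = ennreal B"
    using sup by (cases rule: ennreal_cases) auto
  let ?e = "min 1 \<epsilon>"
  have nn_le: "(\<integral>\<^sup>+\<omega>. ennreal (\<bar>\<xi> i \<omega>\<bar> powr (2 + ?e)) \<partial>M) \<le> ennreal (1 + B)" for i
  proof -
    have "\<bar>x\<bar> powr (2 + ?e) \<le> 1 + \<bar>x\<bar> powr (2 + \<epsilon>)" for x :: real
    proof (cases "\<bar>x\<bar> \<le> 1")
      case True
      then have "\<bar>x\<bar> powr (2 + ?e) \<le> 1" using \<open>\<epsilon> > 0\<close> by (intro powr_le1) auto
      then show ?thesis by (smt (verit) powr_ge_zero)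
    next
      case False
      then have "\<bar>x\<bar> powr (2 + ?e) \<le> \<bar>x\<bar> powr (2 + \<epsilon>)" by (intro powr_mono) auto
      then show ?thesis by simp
    qed
    then have "(\<integral>\<^sup>+\<omega>. ennreal (\<bar>\<xi> i \<omega>\<bar> powr (2 + ?e)) \<partial>M)
        \<le> (\<integral>\<^sup>+\<omega>. 1 + ennreal (\<bar>\<xi> i \<omega>\<bar> powr (2 + \<epsilon>)) \<partial>M)"
      by (intro nn_integral_mono) (metis ennreal_1 ennreal_leI ennreal_plus powr_ge_zero zero_le_one)
    also have "\<dots> = 1 + (\<integral>\<^sup>+\<omega>. ennreal (\<bar>\<xi> i \<omega>\<bar> powr (2 + \<epsilon>)) \<partial>M)"
      by (subst nn_integral_add) (auto simp: emeasure_space_1)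
    also have "\<dots> \<le> 1 + ennreal B"
      unfolding B(2) [symmetric] by (intro add_left_mono SUP_upper) simp
    finally show ?thesis using B(1) by simp
  qed
  have int: "integrable M (\<lambda>\<omega>. \<bar>\<xi> i \<omega>\<bar> powr (2 + ?e))" for i
    using nn_le [of i] by (intro integrableI_bounded) (auto simp: less_top [symmetric] top_unique)
  moreover have "expectation (\<lambda>\<omega>. \<bar>\<xi> i \<omega>\<bar> powr (2 + ?e)) \<le> 1 + B" for i
    using nn_le [of i] B(1) by (simp add: integral_eq_nn_integral enn2real_leI)
  ultimately have "standardized_noise M \<xi> ?e (1 + B)"
    using assms by unfold_locales auto
  then show ?thesis ..
qed

text \<open>An infinite root set counts as \<infinity>, so the zero polynomial is on the side of
  having roots and only existence matters.\<close>

lemma num_roots_eq_0_iff: "num_roots f S = 0 \<longleftrightarrow> (\<forall>z\<in>S. f z \<noteq> 0)"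
  by (auto simp: num_roots_def zero_enat_def dest: not_finite_existsD)

lemma random_poly_eq_local_poly:
  assumes "n > 0"
  shows "random_poly a \<xi> n \<omega> (\<zeta> * (1 + w / of_nat n))
    = of_real (real n ^ \<rho> * sqrt n) * local_poly (\<lambda>i. a n i / (real n ^ \<rho> * sqrt n) * \<xi> i \<omega>) \<zeta> n w"
  using assms by (simp add: random_poly_def local_poly_def sum_distrib_left divide_simps)

text \<open>Multiplication by \<zeta> is a rotation, so the affine change of variable carries one
  ball exactly onto the other; the normalizing constant is nonzero and does not move roots.\<close>

lemma random_poly_zero_in_ball_iff:
  assumes "n > 0" "norm \<zeta> = 1"
  shows "(\<exists>z\<in>ball \<zeta> (r / real n). random_poly a \<xi> n \<omega> z = 0) \<longleftrightarrow>
    (\<exists>w\<in>ball 0 r. local_poly (\<lambda>i. a n i / (real n ^ \<rho> * sqrt n) * \<xi> i \<omega>) \<zeta> n w = 0)"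
proof -
  have \<zeta>: "\<zeta> \<noteq> 0" using assms by auto
  let ?\<phi> = "\<lambda>w. \<zeta> * (1 + w / of_nat n)"
  have "ball \<zeta> (r / real n) = ?\<phi> ` ball 0 r"
  proof (intro equalityI subsetI)
    fix z assume z: "z \<in> ball \<zeta> (r / real n)"
    let ?w = "of_nat n * (z / \<zeta> - 1)"
    have "z / \<zeta> - 1 = (z - \<zeta>) / \<zeta>" using \<zeta> by (simp add: diff_divide_distrib)
    then have "norm ?w = real n * norm (z - \<zeta>)"
      using assms by (simp add: norm_mult norm_divide)
    then have "?w \<in> ball 0 r"
      using z assms by (simp add: dist_norm norm_minus_commute field_simps)
    moreover have "z = ?\<phi> ?w" using assms \<zeta> by simp
    ultimately show "z \<in> ?\<phi> ` ball 0 r" by blast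
  next
    fix z assume "z \<in> ?\<phi> ` ball 0 r"
    then obtain w where w: "norm w < r" "z = ?\<phi> w" by auto
    then have "dist \<zeta> z = norm w / real n"
      using assms by (simp add: dist_norm algebra_simps norm_mult norm_divide)
    with w assms show "z \<in> ball \<zeta> (r / real n)" by (simp add: divide_strict_right_mono)
  qed
  then have "(\<exists>z\<in>ball \<zeta> (r / real n). random_poly a \<xi> n \<omega> z = 0)
      \<longleftrightarrow> (\<exists>w\<in>ball 0 r. random_poly a \<xi> n \<omega> (?\<phi> w) = 0)"
    by simp
  also have "\<dots> \<longleftrightarrow> (\<exists>w\<in>ball 0 r. local_poly (\<lambda>i. a n i / (real n ^ \<rho> * sqrt n) * \<xi> i \<omega>) \<zeta> n w = 0)"
    using assms(1) by (simp add: random_poly_eq_local_poly [where \<rho> = \<rho>])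
  finally show ?thesis .
qed

theorem theorem1p2:
  fixes M :: "'a measure" and \<xi> :: "nat \<Rightarrow> 'a \<Rightarrow> real"
    and \<rho> :: nat and a \<delta> :: "nat \<Rightarrow> nat \<Rightarrow> real" and \<epsilon>\<^sub>0 :: real
  assumes "prob_space M"
    and "prob_space.indep_vars M (\<lambda>_. borel) \<xi> UNIV"
    and "\<And>i. prob_space.expectation M (\<xi> i) = 0"
    and "\<And>i. prob_space.variance M (\<xi> i) = 1"
    and "\<epsilon>\<^sub>0 > 0"
    and "(SUP i. \<integral>\<^sup>+\<omega>. ennreal (\<bar>\<xi> i \<omega>\<bar> powr (2 + \<epsilon>\<^sub>0)) \<partial>M) < \<infinity>"
    and "\<And>n i. i \<le> n \<Longrightarrow> a n i = (1 + \<delta> n i) * falling_prod \<rho> i"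
    and "\<And>\<eta>. \<eta> > 0 \<Longrightarrow> \<forall>\<^sub>F n in sequentially. \<forall>i\<le>n. \<bar>\<delta> n i\<bar> < \<eta>"
  shows "\<forall>\<epsilon>>0. \<exists>c>0. \<exists>C>0. \<forall>\<zeta>::complex. norm \<zeta> = 1 \<longrightarrow>
    (\<forall>\<^sub>F n in sequentially.
       \<P>(\<omega> in M. num_roots (random_poly a \<xi> n \<omega>) (ball \<zeta> (C / real n)) > 0) \<ge> 1 - \<epsilon> \<and>
       \<P>(\<omega> in M. num_roots (random_poly a \<xi> n \<omega>) (ball \<zeta> (c / real n)) = 0) \<ge> 1 - \<epsilon>)"
proof (intro allI impI)
  fix \<epsilon> :: real assume "\<epsilon> > 0"
  obtain K where K: "standardized_noise M \<xi> (min 1 \<epsilon>\<^sub>0) K"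
    using standardized_noiseI [OF assms(1-6)] by blast
  \<comment> \<open>At n = 0 the normalization divides by 0; this is harmless, since all size bounds
    are asserted only for eventually all \<open>n\<close>.\<close>
  interpret scaled_noise M \<xi> "min 1 \<epsilon>\<^sub>0" K "\<lambda>n i. a n i / (real n ^ \<rho> * sqrt n)" \<rho>
    by (intro scaled_noise.intro scaled_noise_axioms.intro K normalized_coefficients [OF assms(7,8)]) auto
  obtain c where c: "c > 0" "\<And>\<zeta>. norm \<zeta> = 1 \<Longrightarrow>
      \<forall>\<^sub>F n in sequentially. prob {\<omega> \<in> space M. \<exists>w\<in>ball 0 c. P \<zeta> n \<omega> w = 0} \<le> \<epsilon>"
    using prob_zero_near_le [OF \<open>\<epsilon> > 0\<close>] by blast
  obtain C where C: "C > 0" "\<And>\<zeta>. norm \<zeta> = 1 \<Longrightarrow>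
      \<forall>\<^sub>F n in sequentially. prob {\<omega> \<in> space M. \<not> (\<exists>w\<in>ball 0 C. P \<zeta> n \<omega> w = 0)} \<le> \<epsilon>"
    using prob_no_zero_near_le [OF \<open>\<epsilon> > 0\<close>] by blast
  have "\<forall>\<^sub>F n in sequentially.
       \<P>(\<omega> in M. num_roots (random_poly a \<xi> n \<omega>) (ball \<zeta> (C / real n)) > 0) \<ge> 1 - \<epsilon> \<and>
       \<P>(\<omega> in M. num_roots (random_poly a \<xi> n \<omega>) (ball \<zeta> (c / real n)) = 0) \<ge> 1 - \<epsilon>"
    if "norm \<zeta> = 1" for \<zeta> :: complex
    using c(2) [OF that] C(2) [OF that] eventually_gt_at_top [of 0]
  proof eventually_elim
    case (elim n)
    have roots: "num_roots (random_poly a \<xi> n \<omega>) (ball \<zeta> (r / real n)) = 0 \<longleftrightarrow>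
        \<not> (\<exists>w\<in>ball 0 r. P \<zeta> n \<omega> w = 0)" for r \<omega>
      using random_poly_zero_in_ball_iff [OF elim(3) that, of r a \<xi> \<omega> \<rho>]
      by (auto simp: num_roots_eq_0_iff)
    show ?case
      using elim(1,2) prob_neg [OF sets_P_zero [where r = C and \<zeta> = \<zeta> and n = n]]
      prob_neg [OF sets_P_zero [where r = c and \<zeta> = \<zeta> and n = n]]
      unfolding zero_less_iff_neq_zero roots not_not by linarith
  qed
  with c(1) C(1) show "\<exists>c>0. \<exists>C>0. \<forall>\<zeta>::complex. norm \<zeta> = 1 \<longrightarrow>
    (\<forall>\<^sub>F n in sequentially.
       \<P>(\<omega> in M. num_roots (random_poly a \<xi> n \<omega>) (ball \<zeta> (C / real n)) > 0) \<ge> 1 - \<epsilon> \<and>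
       \<P>(\<omega> in M. num_roots (random_poly a \<xi> n \<omega>) (ball \<zeta> (c / real n)) = 0) \<ge> 1 - \<epsilon>)"
    by blast
qed

end
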